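(* Let $\lambda\in\mathbb{C}\setminus\{0\}$ with $|\lambda|\neq 1$, let $k\ge1$ be an integer, and let $$A(z_1,z_2)=\left(\lambda(1+p^k)z_1,\ \frac{1}{\lambda(1+p^k)}z_2\right),\qquad p=z_1z_2 .$$ If $F$ is a biholomorphic map germ $(\mathbb{C}^2,0)\to(\mathbb{C}^2,0)$ that is formally conjugate to $A$ (i.e. there is $H\in\mathfrak{G}_2$ with $H^{-1}FH=A$), then $F$ is biholomorphically conjugate to $A$ (i.e. there is a biholomorphic germ $K:(\mathbb{C}^2,0)\to(\mathbb{C}^2,0)$ with $K^{-1}FK=A$).
   Context: $\mathfrak{G}_2$ is the group, under formal composition, of formally invertible formal power series self-maps of $\mathbb{C}^2$ without constant term (pairs of formal power series in $z_1,z_2$ with complex coefficients, zero constant term, and invertible linear part). Biholomorphic germs fixing $0$ are identified with the elements of $\mathfrak{G}_2$ whose series converge near $0$. *)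

theory Defs
  imports "HOL-Analysis.Analysis" "HOL-Computational_Algebra.Formal_Power_Series" "HOL-Algebra.Group"
begin

text \<open>
  The ring of formal power series in \<open>z\<^sub>1\<close>, \<open>z\<^sub>2\<close> is realised as iterated series: the outer variable
  is \<open>z\<^sub>1\<close>, the inner one is \<open>z\<^sub>2\<close>.
\<close>

type_synonym fps2 = "complex fps fps"

definition coeff2 :: "fps2 \<Rightarrow> nat \<Rightarrow> nat \<Rightarrow> complex" where
  "coeff2 f i j = fps_nth (fps_nth f i) j"

definition Z1 :: fps2 where "Z1 = fps_X"

definition Z2 :: fps2 where "Z2 = fps_const fps_X"

definition const2 :: "complex \<Rightarrow> fps2" where
  "const2 c = fps_const (fps_const c)"

text \<open>
  \<open>subst2 f (g\<^sub>1, g\<^sub>2) = \<Sum>\<^sub>i\<^sub>j f\<^sub>i\<^sub>j g\<^sub>1^i g\<^sub>2^j\<close>, meaningful only if \<open>g\<^sub>1\<close>, \<open>g\<^sub>2\<close> have no constant term: then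
  \<open>g\<^sub>1^i g\<^sub>2^j\<close> has order at least \<open>i + j\<close>, so that the finite sum below is the full coefficient of
  \<open>z\<^sub>1^m z\<^sub>2^n\<close>.
\<close>

definition subst2 :: "fps2 \<Rightarrow> fps2 \<times> fps2 \<Rightarrow> fps2" where
  "subst2 f G = Abs_fps (\<lambda>m. Abs_fps (\<lambda>n.
     \<Sum>(i, j) \<in> {(i, j). i + j \<le> m + n}. coeff2 f i j * coeff2 (fst G ^ i * snd G ^ j) m n))"

definition comp2 :: "fps2 \<times> fps2 \<Rightarrow> fps2 \<times> fps2 \<Rightarrow> fps2 \<times> fps2" where
  "comp2 F G = (subst2 (fst F) G, subst2 (snd F) G)"

definition linear_part :: "fps2 \<times> fps2 \<Rightarrow> complex^2^2" where
  "linear_part F = vector [vector [coeff2 (fst F) 1 0, coeff2 (fst F) 0 1],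
                           vector [coeff2 (snd F) 1 0, coeff2 (snd F) 0 1]]"

definition G2 :: "(fps2 \<times> fps2) monoid" where
  "G2 = \<lparr>carrier = {F. coeff2 (fst F) 0 0 = 0 \<and> coeff2 (snd F) 0 0 = 0 \<and> invertible (linear_part F)},
         mult = comp2, one = (Z1, Z2)\<rparr>"

text \<open>
  Summability over the index set \<open>UNIV\<close> of pairs is unconditional, hence absolute, convergence.
\<close>

definition convergent2 :: "fps2 \<Rightarrow> bool" where
  "convergent2 f \<longleftrightarrow> (\<exists>r>0. \<forall>z1 z2. cmod z1 < r \<longrightarrow> cmod z2 < r \<longrightarrow>
     (\<lambda>(i, j). coeff2 f i j * z1 ^ i * z2 ^ j) summable_on UNIV)"

text \<open>
  Biholomorphic germs \<open>(\<complex>\<^sup>2, 0) \<rightarrow> (\<complex>\<^sup>2, 0)\<close>, identified with their Taylor series at \<open>0\<close>.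
\<close>

definition biholomorphic_germs :: "(fps2 \<times> fps2) set" where
  "biholomorphic_germs = {F \<in> carrier G2. convergent2 (fst F) \<and> convergent2 (snd F)}"

definition mapA :: "complex \<Rightarrow> nat \<Rightarrow> fps2 \<times> fps2" where
  "mapA c k = (let u = const2 c * (1 + (Z1 * Z2) ^ k) in (u * Z1, inverse u * Z2))"

text \<open>
  The library's \<^const>\<open>inverse\<close> on an iterated series is the reciprocal for the unit occurring in
  \<^const>\<open>mapA\<close>.
\<close>

lemma mapA_unit:
  assumes "c \<noteq> 0" "k \<ge> 1"
  shows "(const2 c * (1 + (Z1 * Z2) ^ k)) * inverse (const2 c * (1 + (Z1 * Z2) ^ k)) = 1"
proof -
  let ?u = "const2 c * (1 + (Z1 * Z2) ^ k)"
  have "fps_nth ?u 0 = fps_const c"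
    using assms by (simp add: const2_def Z1_def Z2_def fps_nth_power_0)
  moreover have "fps_const c * inverse (fps_const c) = 1"
    using assms by (simp add: fps_const_inverse)
  ultimately have "?u * fps_right_inverse ?u (inverse (fps_nth ?u 0)) = 1"
    by (intro fps_right_inverse) auto
  then show ?thesis
    by (simp add: fps_inverse_def)
qed

end

theory Submission
  imports Defs
begin

text \<open>
  After a linear change of coordinates the formal conjugacy \<open>H\<close> is tangent to the identity. Dividing it by
  its resonant part \<open>D\<close> gives a conjugacy from \<open>F\<close> to \<open>N = D A D\<^sup>-\<^sup>1 = (u z\<^sub>1, v z\<^sub>2)\<close>, where \<open>u = \<lambda>(1 + w)\<close> and
  \<open>v\<close> are series in \<open>z\<^sub>1 z\<^sub>2\<close> and, because \<open>A\<close> preserves \<open>z\<^sub>1 z\<^sub>2\<close>, \<open>u v = 1\<close>. Then \<open>N\<close> multiplies the part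
  \<open>\<phi>\<^sub>d\<close> of weight \<open>d\<close> (spanned by the \<open>z\<^sub>1\<^sup>i z\<^sub>2\<^sup>j\<close> with \<open>i - j = d\<close>) by \<open>u\<^sup>d\<close>, so the conjugacy equation reads
  \<open>(u\<^sup>d - \<lambda>) \<phi>\<^sub>d = [f(H)]\<^sub>d\<close>, with \<open>f\<close> the nonlinear part of \<open>F\<close>. Since \<open>|\<lambda>| \<noteq> 1\<close> there are no small divisors:
  \<open>u\<^sup>d - \<lambda>\<close> is invertible uniformly in \<open>d \<noteq> 1\<close>, while for \<open>d = 1\<close> the normalisation \<open>\<phi>\<^sub>1 = z\<^sub>1\<close> turns the
  equation into a formula for \<open>w\<close>. As \<open>f\<close> has order two, the truncation of \<open>H\<close> at degree \<open>n + 1\<close> is bounded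
  through its truncation at degree \<open>n\<close>, and induction yields a bound in a weighted \<open>l\<^sup>1\<close> norm that is uniform in
  \<open>n\<close>, both for \<open>H\<close> and for \<open>w\<close>. Finally \<open>w = (z\<^sub>1 z\<^sub>2 s)\<^sup>k\<close>, hence \<open>s\<close> converges, and \<open>(z\<^sub>1, z\<^sub>2 s)\<close>
  conjugates \<open>N\<close> to \<open>A\<close>.
\<close>

section \<open>Coefficients and vanishing order of series in two variables\<close>

definition ord_ge :: "nat \<Rightarrow> fps2 \<Rightarrow> bool" where
  "ord_ge s f \<longleftrightarrow> (\<forall>i j. i + j < s \<longrightarrow> coeff2 f i j = 0)"

definition tri :: "nat \<Rightarrow> (nat \<times> nat) set" where
  "tri n = {(i, j). i + j \<le> n}"

lemma finite_tri [simp]: "finite (tri n)"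
proof -
  have "tri n \<subseteq> {..n} \<times> {..n}" by (auto simp: tri_def)
  then show ?thesis by (rule finite_subset) simp
qed

lemma mem_tri [simp]: "(i, j) \<in> tri n \<longleftrightarrow> i + j \<le> n"
  by (simp add: tri_def)

lemma tri_mono: "m \<le> n \<Longrightarrow> tri m \<subseteq> tri n"
  by (auto simp: tri_def)

lemma fps2_eqI: "(\<And>i j. coeff2 f i j = coeff2 g i j) \<Longrightarrow> f = g"
  by (simp add: coeff2_def fps_eq_iff)

lemma coeff2_0 [simp]: "coeff2 0 i j = 0"
  by (simp add: coeff2_def)

lemma coeff2_1: "coeff2 1 i j = (if i = 0 \<and> j = 0 then 1 else 0)"
  by (simp add: coeff2_def)

lemma coeff2_add [simp]: "coeff2 (f + g) i j = coeff2 f i j + coeff2 g i j"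
  by (simp add: coeff2_def)

lemma coeff2_diff [simp]: "coeff2 (f - g) i j = coeff2 f i j - coeff2 g i j"
  by (simp add: coeff2_def)

lemma coeff2_uminus [simp]: "coeff2 (- f) i j = - coeff2 f i j"
  by (simp add: coeff2_def)

lemma coeff2_sum: "coeff2 (sum f A) i j = (\<Sum>a\<in>A. coeff2 (f a) i j)"
  by (simp add: coeff2_def fps_sum_nth)

lemma coeff2_const_mult [simp]: "coeff2 (const2 c * f) i j = c * coeff2 f i j"
  by (simp add: coeff2_def const2_def)

lemma coeff2_const2: "coeff2 (const2 c) i j = (if i = 0 \<and> j = 0 then c else 0)"
  by (simp add: coeff2_def const2_def)

lemma const2_1 [simp]: "const2 1 = 1"
  by (simp add: const2_def)

lemma const2_mult: "const2 (a * b) = const2 a * const2 b"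
  by (intro fps2_eqI) (simp add: coeff2_const2)

lemma coeff2_Z1: "coeff2 Z1 i j = (if i = Suc 0 \<and> j = 0 then 1 else 0)"
  by (simp add: coeff2_def Z1_def fps_X_def)

lemma coeff2_Z2: "coeff2 Z2 i j = (if i = 0 \<and> j = Suc 0 then 1 else 0)"
  by (auto simp: coeff2_def Z2_def fps_X_def)

lemma coeff2_mult:
  "coeff2 (f * g) m l = (\<Sum>(a, b)\<in>{..m} \<times> {..l}. coeff2 f a b * coeff2 g (m - a) (l - b))"
  by (simp add: coeff2_def fps_mult_nth fps_sum_nth sum.cartesian_product atMost_atLeast0)

lemma coeff2_Z1_mult: "coeff2 (Z1 * f) i j = (if i = 0 then 0 else coeff2 f (i - 1) j)"
  by (simp add: coeff2_def Z1_def)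

lemma coeff2_Z2_mult: "coeff2 (Z2 * f) i j = (if j = 0 then 0 else coeff2 f i (j - 1))"
  by (simp add: coeff2_def Z2_def)

definition tri2 :: "nat \<Rightarrow> ((nat \<times> nat) \<times> (nat \<times> nat)) set" where
  "tri2 n = {((a, b), (c, d)). a + b + c + d \<le> n}"

lemma tri2_subset: "tri2 n \<subseteq> tri n \<times> tri n"
  by (auto simp: tri2_def)

lemma finite_tri2 [simp]: "finite (tri2 n)"
  using tri2_subset by (rule finite_subset) simp

text \<open>The change of index \<open>(c, d) = (m - a, l - b)\<close> is a bijection. Both the
  multiplicativity of substitution and the submultiplicativity of the truncated norms rest on
  it.\<close>

lemma sum_tri_convolution:
  fixes \<Phi> :: "nat \<Rightarrow> nat \<Rightarrow> nat \<Rightarrow> nat \<Rightarrow> 'a::comm_monoid_add"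
  shows "(\<Sum>(m, l)\<in>tri N. \<Sum>(a, b)\<in>{..m} \<times> {..l}. \<Phi> a b (m - a) (l - b))
    = (\<Sum>((a, b), (c, d))\<in>tri2 N. \<Phi> a b c d)"
proof -
  have "(\<Sum>(m, l)\<in>tri N. \<Sum>(a, b)\<in>{..m} \<times> {..l}. \<Phi> a b (m - a) (l - b))
    = (\<Sum>((m, l), (a, b))\<in>(SIGMA (m, l):tri N. {..m} \<times> {..l}). \<Phi> a b (m - a) (l - b))"
    by (simp add: sum.Sigma split_def)
  also have "\<dots> = (\<Sum>((a, b), (c, d))\<in>tri2 N. \<Phi> a b c d)"
    by (rule sum.reindex_bij_witness
        [where i = "\<lambda>((a, b), (c, d)). ((a + c, b + d), (a, b))"
           and j = "\<lambda>((m, l), (a, b)). ((a, b), (m - a, l - b))"])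
       (auto simp: tri2_def)
  finally show ?thesis .
qed

lemma ord_ge_0 [simp]: "ord_ge 0 f"
  by (simp add: ord_ge_def)

lemma ord_geD: "ord_ge s f \<Longrightarrow> i + j < s \<Longrightarrow> coeff2 f i j = 0"
  by (simp add: ord_ge_def)

lemma ord_ge_Suc_0_iff: "ord_ge (Suc 0) f \<longleftrightarrow> coeff2 f 0 0 = 0"
  by (simp add: ord_ge_def)

lemma ord_ge_mono: "ord_ge s f \<Longrightarrow> t \<le> s \<Longrightarrow> ord_ge t f"
  by (simp add: ord_ge_def)

lemma ord_ge_add: "ord_ge s f \<Longrightarrow> ord_ge s g \<Longrightarrow> ord_ge s (f + g)"
  and ord_ge_diff: "ord_ge s f \<Longrightarrow> ord_ge s g \<Longrightarrow> ord_ge s (f - g)"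
  and ord_ge_const_mult: "ord_ge s f \<Longrightarrow> ord_ge s (const2 c * f)"
  by (simp_all add: ord_ge_def)

lemma ord_ge_mult:
  assumes "ord_ge s f" "ord_ge t g"
  shows "ord_ge (s + t) (f * g)"
  unfolding ord_ge_def
proof (intro allI impI)
  fix i j assume ij: "i + j < s + t"
  have "coeff2 f a b * coeff2 g (i - a) (j - b) = 0" if "a \<le> i" "b \<le> j" for a b
  proof (cases "a + b < s")
    case False
    then have "(i - a) + (j - b) < t" using ij that by linarith
    then show ?thesis using assms(2) by (simp add: ord_ge_def)
  qed (use assms(1) in \<open>simp add: ord_ge_def\<close>)
  then show "coeff2 (f * g) i j = 0"
    unfolding coeff2_mult by (intro sum.neutral) auto
qed

lemma ord_ge_power: "ord_ge (Suc 0) f \<Longrightarrow> ord_ge n (f ^ n)"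
  by (induction n) (use ord_ge_mult[of "Suc 0" f] in auto)

lemma ord_ge_monom: "ord_ge (Suc 0) f \<Longrightarrow> ord_ge (Suc 0) g \<Longrightarrow> ord_ge (i + j) (f ^ i * g ^ j)"
  by (intro ord_ge_mult ord_ge_power)

lemma ord_ge_Z1 [simp]: "ord_ge (Suc 0) Z1" and ord_ge_Z2 [simp]: "ord_ge (Suc 0) Z2"
  by (simp_all add: ord_ge_Suc_0_iff coeff2_Z1 coeff2_Z2)

section \<open>Substitution and the group of formal self-maps\<close>

abbreviation no_const :: "fps2 \<times> fps2 \<Rightarrow> bool" where
  "no_const G \<equiv> ord_ge (Suc 0) (fst G) \<and> ord_ge (Suc 0) (snd G)"

abbreviation monom2 :: "fps2 \<times> fps2 \<Rightarrow> nat \<Rightarrow> nat \<Rightarrow> fps2" where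
  "monom2 G i j \<equiv> fst G ^ i * snd G ^ j"

lemma coeff2_subst2_raw:
  "coeff2 (subst2 f G) m n = (\<Sum>(i, j)\<in>tri (m + n). coeff2 f i j * coeff2 (monom2 G i j) m n)"
  by (simp add: coeff2_def subst2_def tri_def)

text \<open>Monomials of degree above \<open>m + n\<close> in series without constant term
  contribute nothing. A range independent of \<open>m\<close> and \<open>n\<close> is what later
  permits exchanging sums.\<close>

lemma coeff2_subst2:
  assumes "no_const G" "m + n \<le> N"
  shows "coeff2 (subst2 f G) m n = (\<Sum>(i, j)\<in>tri N. coeff2 f i j * coeff2 (monom2 G i j) m n)"
  unfolding coeff2_subst2_raw
proof (rule sum.mono_neutral_left)
  show "\<forall>x\<in>tri N - tri (m + n). (case x of (i, j) \<Rightarrow> coeff2 f i j * coeff2 (monom2 G i j) m n) = 0"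
  proof (clarify)
    fix i j assume "(i, j) \<notin> tri (m + n)"
    then have "m + n < i + j" by simp
    then have "coeff2 (monom2 G i j) m n = 0"
      using assms(1) by (intro ord_geD[OF ord_ge_monom]) auto
    then show "coeff2 f i j * coeff2 (monom2 G i j) m n = 0" by simp
  qed
qed (use assms(2) in \<open>auto intro: tri_mono[THEN subsetD]\<close>)

lemma subst2_add [simp]: "subst2 (f + g) G = subst2 f G + subst2 g G"
  by (intro fps2_eqI) (simp add: coeff2_subst2_raw sum.distrib[symmetric] split_def algebra_simps)

lemma subst2_diff [simp]: "subst2 (f - g) G = subst2 f G - subst2 g G"
  by (intro fps2_eqI) (simp add: coeff2_subst2_raw sum_subtractf[symmetric] split_def algebra_simps)

lemma subst2_const_mult [simp]: "subst2 (const2 c * f) G = const2 c * subst2 f G"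
  by (intro fps2_eqI) (simp add: coeff2_subst2_raw sum_distrib_left split_def mult.assoc)

lemma subst2_one [simp]: "subst2 1 G = 1"
proof (intro fps2_eqI)
  fix m n
  have "coeff2 (subst2 1 G) m n = (\<Sum>x\<in>tri (m+n). if x = (0,0) then coeff2 (monom2 G 0 0) m n else 0)"
    unfolding coeff2_subst2_raw by (intro sum.cong) (auto simp: coeff2_1 split: if_splits)
  then show "coeff2 (subst2 1 G) m n = coeff2 1 m n" by simp
qed

lemma subst2_Z1 [simp]:
  assumes "no_const G" shows "subst2 Z1 G = fst G"
proof (intro fps2_eqI)
  fix m n
  have "coeff2 (subst2 Z1 G) m n
      = (\<Sum>(i, j)\<in>tri (Suc (m + n)). coeff2 Z1 i j * coeff2 (monom2 G i j) m n)"
    by (rule coeff2_subst2) (use assms in auto)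
  also have "\<dots> = (\<Sum>x\<in>tri (Suc (m + n)). if x = (Suc 0, 0) then coeff2 (fst G) m n else 0)"
    by (intro sum.cong) (auto simp: coeff2_Z1 split: if_splits)
  finally show "coeff2 (subst2 Z1 G) m n = coeff2 (fst G) m n" by simp
qed

lemma subst2_Z2 [simp]:
  assumes "no_const G" shows "subst2 Z2 G = snd G"
proof (intro fps2_eqI)
  fix m n
  have "coeff2 (subst2 Z2 G) m n
      = (\<Sum>(i, j)\<in>tri (Suc (m + n)). coeff2 Z2 i j * coeff2 (monom2 G i j) m n)"
    by (rule coeff2_subst2) (use assms in auto)
  also have "\<dots> = (\<Sum>x\<in>tri (Suc (m + n)). if x = (0, Suc 0) then coeff2 (snd G) m n else 0)"
    by (intro sum.cong) (auto simp: coeff2_Z2 split: if_splits)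
  finally show "coeff2 (subst2 Z2 G) m n = coeff2 (snd G) m n" by simp
qed

lemma subst2_mult:
  assumes "no_const G"
  shows "subst2 (f * g) G = subst2 f G * subst2 g G"
proof (intro fps2_eqI)
  fix m n :: nat
  let ?N = "m + n"
  let ?c = "\<lambda>a b c d. coeff2 f a b * coeff2 g c d * coeff2 (monom2 G a b * monom2 G c d) m n"
  have split: "monom2 G i j = monom2 G a b * monom2 G (i - a) (j - b)" if "a \<le> i" "b \<le> j" for i j a b
    by (metis (no_types, lifting) that le_add_diff_inverse mult.assoc mult.left_commute power_add)
  have conv: "?c a b c d = (\<Sum>(x, y)\<in>{..m} \<times> {..n}.
      (coeff2 f a b * coeff2 (monom2 G a b) x y) * (coeff2 g c d * coeff2 (monom2 G c d) (m - x) (n - y)))"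
    for a b c d
    unfolding coeff2_mult[of "monom2 G a b" "monom2 G c d"] sum_distrib_left
    by (intro sum.cong) (auto simp: mult_ac)
  have "coeff2 (f * g) i j * coeff2 (monom2 G i j) m n
      = (\<Sum>(a, b)\<in>{..i} \<times> {..j}. ?c a b (i - a) (j - b))" for i j
    unfolding coeff2_mult[of f g] sum_distrib_right
    by (rule sum.cong) (auto simp: split[symmetric])
  then have "coeff2 (subst2 (f * g) G) m n
      = (\<Sum>(i, j)\<in>tri ?N. \<Sum>(a, b)\<in>{..i} \<times> {..j}. ?c a b (i - a) (j - b))"
    by (simp add: coeff2_subst2_raw)
  also have "\<dots> = (\<Sum>((a, b), (c, d))\<in>tri2 ?N. ?c a b c d)"
    by (rule sum_tri_convolution)
  \<comment> \<open>Outside \<open>tri2\<close> the product of the two monomials has order above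
    \<open>m + n\<close>, so the range may be completed to a product, over which the sum
    factors.\<close>
  also have "\<dots> = (\<Sum>((a, b), (c, d))\<in>tri ?N \<times> tri ?N. ?c a b c d)"
  proof (rule sum.mono_neutral_left)
    show "\<forall>x\<in>tri ?N \<times> tri ?N - tri2 ?N. (\<lambda>((a, b), (c, d)). ?c a b c d) x = 0"
    proof
      fix x assume x: "x \<in> tri ?N \<times> tri ?N - tri2 ?N"
      obtain a b c d where abcd: "x = ((a, b), (c, d))" by (metis surj_pair)
      then have "?N < (a + b) + (c + d)" using x by (simp add: tri2_def)
      then have "coeff2 (monom2 G a b * monom2 G c d) m n = 0"
        using assms by (intro ord_geD[OF ord_ge_mult[OF ord_ge_monom ord_ge_monom]]) auto
      then show "(\<lambda>((a, b), (c, d)). ?c a b c d) x = 0" by (simp add: abcd)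
    qed
  qed (use tri2_subset in auto)
  also have "\<dots> = (\<Sum>((a, b), (c, d))\<in>tri ?N \<times> tri ?N. \<Sum>(x, y)\<in>{..m} \<times> {..n}.
      (coeff2 f a b * coeff2 (monom2 G a b) x y) * (coeff2 g c d * coeff2 (monom2 G c d) (m - x) (n - y)))"
    by (simp only: conv)
  also have "\<dots> = (\<Sum>(x, y)\<in>{..m} \<times> {..n}. \<Sum>((a, b), (c, d))\<in>tri ?N \<times> tri ?N.
      (coeff2 f a b * coeff2 (monom2 G a b) x y) * (coeff2 g c d * coeff2 (monom2 G c d) (m - x) (n - y)))"
    unfolding split_def by (rule sum.swap)
  also have "\<dots> = (\<Sum>(x, y)\<in>{..m} \<times> {..n}. coeff2 (subst2 f G) x y * coeff2 (subst2 g G) (m - x) (n - y))"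
  proof (rule sum.cong[OF refl])
    fix p assume "p \<in> {..m} \<times> {..n}"
    then obtain x y where p: "p = (x, y)" and xy: "x \<le> m" "y \<le> n" by auto
    have "coeff2 (subst2 f G) x y = (\<Sum>(i, j)\<in>tri ?N. coeff2 f i j * coeff2 (monom2 G i j) x y)"
      using xy by (intro coeff2_subst2 assms) auto
    moreover have "coeff2 (subst2 g G) (m - x) (n - y)
        = (\<Sum>(i, j)\<in>tri ?N. coeff2 g i j * coeff2 (monom2 G i j) (m - x) (n - y))"
      using xy by (intro coeff2_subst2 assms) auto
    ultimately show "(case p of (x, y) \<Rightarrow> \<Sum>((a, b), (c, d))\<in>tri ?N \<times> tri ?N.
      (coeff2 f a b * coeff2 (monom2 G a b) x y) * (coeff2 g c d * coeff2 (monom2 G c d) (m - x) (n - y)))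
      = (case p of (x, y) \<Rightarrow> coeff2 (subst2 f G) x y * coeff2 (subst2 g G) (m - x) (n - y))"
      by (simp add: p sum_product sum.cartesian_product split_def)
  qed
  also have "\<dots> = coeff2 (subst2 f G * subst2 g G) m n"
    by (simp add: coeff2_mult)
  finally show "coeff2 (subst2 (f * g) G) m n = coeff2 (subst2 f G * subst2 g G) m n" .
qed

lemma subst2_power: "no_const G \<Longrightarrow> subst2 (f ^ n) G = subst2 f G ^ n"
  by (induction n) (simp_all add: subst2_mult)

lemma subst2_const2 [simp]: "subst2 (const2 c) G = const2 c"
  using subst2_const_mult[of c 1 G] by simp

lemma ord_ge_subst2:
  assumes "ord_ge s f" "no_const G"
  shows "ord_ge s (subst2 f G)"
  unfolding ord_ge_def coeff2_subst2_raw
  using assms(1) by (auto intro!: sum.neutral simp: ord_ge_def)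

lemma no_const_comp2: "no_const F \<Longrightarrow> no_const G \<Longrightarrow> no_const (comp2 F G)"
  by (simp add: comp2_def ord_ge_subst2)

lemma fst_comp2 [simp]: "fst (comp2 F G) = subst2 (fst F) G"
  and snd_comp2 [simp]: "snd (comp2 F G) = subst2 (snd F) G"
  by (simp_all add: comp2_def)

text \<open>Substitution is linear in the outer series and multiplicative, so only the monomials of
  \<open>f\<close> matter; all sums run over one finite triangle and can be exchanged.\<close>

lemma subst2_subst2:
  assumes "no_const G" "no_const H"
  shows "subst2 (subst2 f G) H = subst2 f (comp2 G H)"
proof (intro fps2_eqI)
  fix m n :: nat
  let ?N = "m + n"
  have "coeff2 (subst2 (subst2 f G) H) m n
     = (\<Sum>(i, j)\<in>tri ?N. (\<Sum>(a, b)\<in>tri ?N. coeff2 f a b * coeff2 (monom2 G a b) i j) * coeff2 (monom2 H i j) m n)"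
    unfolding coeff2_subst2_raw[of "subst2 f G"]
    by (intro sum.cong refl) (auto simp: coeff2_subst2[OF assms(1), where N = ?N])
  also have "\<dots> = (\<Sum>(i, j)\<in>tri ?N. \<Sum>(a, b)\<in>tri ?N. coeff2 f a b * (coeff2 (monom2 G a b) i j * coeff2 (monom2 H i j) m n))"
    by (simp add: sum_distrib_left sum_distrib_right split_def mult_ac)
  also have "\<dots> = (\<Sum>(a, b)\<in>tri ?N. \<Sum>(i, j)\<in>tri ?N. coeff2 f a b * (coeff2 (monom2 G a b) i j * coeff2 (monom2 H i j) m n))"
    unfolding split_def by (rule sum.swap)
  also have "\<dots> = (\<Sum>(a, b)\<in>tri ?N. coeff2 f a b * coeff2 (subst2 (monom2 G a b) H) m n)"
    by (simp add: coeff2_subst2_raw sum_distrib_left split_def)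
  also have "\<dots> = coeff2 (subst2 f (comp2 G H)) m n"
    by (simp add: coeff2_subst2_raw[of f] subst2_mult[OF assms(2)] subst2_power[OF assms(2)])
  finally show "coeff2 (subst2 (subst2 f G) H) m n = coeff2 (subst2 f (comp2 G H)) m n" .
qed

lemma comp2_assoc:
  "no_const G \<Longrightarrow> no_const H \<Longrightarrow> comp2 (comp2 F G) H = comp2 F (comp2 G H)"
  by (simp add: comp2_def[of F] comp2_def[of "comp2 F G"] comp2_def[of "(subst2 (fst F) G, subst2 (snd F) G)"] subst2_subst2)

lemma coeff2_monom: "coeff2 (Z1 ^ i * Z2 ^ j) m n = (if m = i \<and> n = j then 1 else 0)"
proof (induction i arbitrary: m)
  case 0
  show ?case
  proof (induction j arbitrary: n)
    case (Suc j)
    then show ?case by (cases n) (auto simp: coeff2_Z2_mult)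
  qed (auto simp: coeff2_1)
next
  case (Suc i)
  then show ?case by (cases m) (auto simp: coeff2_Z1_mult mult.assoc)
qed

lemma subst2_id [simp]: "subst2 f (Z1, Z2) = f"
proof (intro fps2_eqI)
  fix m n
  have "coeff2 (subst2 f (Z1, Z2)) m n = (\<Sum>x\<in>tri (m + n). if x = (m, n) then coeff2 f m n else 0)"
    unfolding coeff2_subst2_raw by (intro sum.cong) (auto simp: coeff2_monom split: if_splits)
  then show "coeff2 (subst2 f (Z1, Z2)) m n = coeff2 f m n" by simp
qed


section \<open>Congruence up to a given order and formal fixed points\<close>

definition cong2 :: "nat \<Rightarrow> fps2 \<times> fps2 \<Rightarrow> fps2 \<times> fps2 \<Rightarrow> bool" where
  "cong2 n F G \<longleftrightarrow> ord_ge n (fst F - fst G) \<and> ord_ge n (snd F - snd G)"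

lemma cong2_0 [simp]: "cong2 0 F G"
  by (simp add: cong2_def)

lemma ord_ge_diff_mult:
  fixes f f' g g' :: fps2
  assumes "ord_ge n (f - f')" "ord_ge n (g - g')"
  shows "ord_ge n (f * g - f' * g')"
proof -
  have "f * g - f' * g' = (f - f') * g + f' * (g - g')" by (simp add: algebra_simps)
  moreover have "ord_ge n ((f - f') * g)" using ord_ge_mult[OF assms(1) ord_ge_0[of g]] by simp
  moreover have "ord_ge n (f' * (g - g'))" using ord_ge_mult[OF ord_ge_0[of f'] assms(2)] by simp
  ultimately show ?thesis by (simp add: ord_ge_add)
qed

lemma cong2_monom:
  assumes "cong2 n F G"
  shows "ord_ge n (monom2 F i j - monom2 G i j)"
proof -
  have pw: "ord_ge n (f ^ i - g ^ i)" if "ord_ge n (f - g)" for f g and i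
  proof (induction i)
    case 0 then show ?case by (simp add: ord_ge_def)
  next
    case (Suc i) then show ?case using ord_ge_diff_mult[OF that] by simp
  qed
  show ?thesis using assms by (intro ord_ge_diff_mult pw) (auto simp: cong2_def)
qed

lemma ord_ge_diff_mult_Suc:
  fixes f f' g g' :: fps2
  assumes "ord_ge n (f - f')" "ord_ge n (g - g')" "ord_ge (Suc 0) f'" "ord_ge (Suc 0) g"
  shows "ord_ge (Suc n) (f * g - f' * g')"
proof -
  have "f * g - f' * g' = (f - f') * g + f' * (g - g')" by (simp add: algebra_simps)
  moreover have "ord_ge (Suc n) ((f - f') * g)" using ord_ge_mult[OF assms(1,4)] by simp
  moreover have "ord_ge (Suc n) (f' * (g - g'))" using ord_ge_mult[OF assms(3,2)] by simp
  ultimately show ?thesis by (simp add: ord_ge_add)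
qed

text \<open>One factor is split off; in the telescoped difference each summand pairs a difference of
  order \<open>n\<close> with a factor without constant term. This gain of one degree makes
  substitution into a series of order two contracting.\<close>

lemma cong2_monom_Suc:
  assumes "cong2 n F G" "no_const F" "no_const G" "2 \<le> i + j"
  shows "ord_ge (Suc n) (monom2 F i j - monom2 G i j)"
proof (cases i)
  case (Suc a)
  have "ord_ge (Suc 0) (monom2 F a j)"
    using assms Suc by (intro ord_ge_mono[OF ord_ge_monom[of _ _ a j]]) auto
  then have "ord_ge (Suc n) (fst F * monom2 F a j - fst G * monom2 G a j)"
    using assms by (intro ord_ge_diff_mult_Suc cong2_monom) (auto simp: cong2_def)
  then show ?thesis using Suc by (simp add: mult.assoc)
next
  case 0
  then obtain b where b: "j = Suc b" "1 \<le> b" using assms(4) by (cases j) auto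
  have "ord_ge (Suc 0) (monom2 F 0 b)"
    using assms b by (intro ord_ge_mono[OF ord_ge_monom[of _ _ 0 b]]) auto
  then have "ord_ge (Suc n) (snd F * monom2 F 0 b - snd G * monom2 G 0 b)"
    using assms by (intro ord_ge_diff_mult_Suc cong2_monom) (auto simp: cong2_def)
  then show ?thesis using 0 b by simp
qed

lemma cong2_subst2:
  assumes "ord_ge 2 f" "cong2 n F G" "no_const F" "no_const G"
  shows "ord_ge (Suc n) (subst2 f F - subst2 f G)"
  unfolding ord_ge_def
proof (intro allI impI)
  fix p q assume pq: "p + q < Suc n"
  have "coeff2 f i j * coeff2 (monom2 F i j) p q = coeff2 f i j * coeff2 (monom2 G i j) p q" for i j
  proof (cases "i + j < 2")
    case False
    then have "coeff2 (monom2 F i j - monom2 G i j) p q = 0"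
      using pq assms by (intro ord_geD[OF cong2_monom_Suc]) auto
    then show ?thesis by simp
  qed (use assms(1) in \<open>simp add: ord_ge_def\<close>)
  then show "coeff2 (subst2 f F - subst2 f G) p q = 0"
    by (simp only: coeff2_diff coeff2_subst2_raw) simp
qed

text \<open>The solution is the coefficientwise limit of the iterates \<open>T\<^sup>n(0)\<close>.\<close>

lemma formal_fixed_point:
  fixes T :: "fps2 \<times> fps2 \<Rightarrow> fps2 \<times> fps2"
  assumes closed: "\<And>X. no_const X \<Longrightarrow> no_const (T X)"
    and contr: "\<And>X Y n. no_const X \<Longrightarrow> no_const Y \<Longrightarrow> cong2 n X Y \<Longrightarrow> cong2 (Suc n) (T X) (T Y)"
  obtains X where "no_const X" "T X = X"
proof -
  define S where "S n = (T ^^ n) (0, 0)" for n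
  have nc: "no_const (S n)" for n
  proof (induction n)
    case (Suc n) then show ?case using closed[of "S n"] by (simp add: S_def)
  qed (simp add: S_def ord_ge_def)
  have step: "cong2 n (S n) (S (Suc n))" for n
  proof (induction n)
    case (Suc n) then show ?case using contr[OF nc nc Suc] by (simp add: S_def)
  qed simp
  have le: "cong2 n (S n) (S (n + m))" for n m
  proof (induction m)
    case (Suc m)
    have "cong2 n (S (n + m)) (S (n + Suc m))"
      using step[of "n + m"] by (auto simp: cong2_def intro: ord_ge_mono)
    with Suc show ?case by (auto simp: cong2_def ord_ge_def)
  qed (simp add: cong2_def ord_ge_def)
  \<comment> \<open>The coefficient at \<open>(i, j)\<close> is stable from the iterate with index
    \<open>i + j + 1\<close> on.\<close>
  define L where "L h = Abs_fps (\<lambda>i. Abs_fps (\<lambda>j. coeff2 (h (S (Suc (i + j)))) i j))"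
    for h :: "fps2 \<times> fps2 \<Rightarrow> fps2"
  have L: "coeff2 (L h) i j = coeff2 (h (S (Suc (i + j)))) i j" for h i j
    by (simp add: L_def coeff2_def)
  define X where "X = (L fst, L snd)"
  have SX: "cong2 n (S n) X" for n
    unfolding cong2_def ord_ge_def
  proof (intro conjI allI impI)
    fix i j assume "i + j < n"
    then obtain m where m: "n = Suc (i + j) + m" by (metis Suc_leI le_add_diff_inverse)
    show "coeff2 (fst (S n) - fst X) i j = 0" "coeff2 (snd (S n) - snd X) i j = 0"
      using le[of "Suc (i + j)" m] unfolding m by (auto simp: X_def L cong2_def ord_ge_def)
  qed
  have ncX: "no_const X"
    using SX[of 1] nc[of 1] by (auto simp: cong2_def ord_ge_Suc_0_iff)
  have "cong2 n (T X) X" for n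
  proof -
    have "cong2 (Suc n) (T (S n)) (T X)" using contr[OF nc ncX SX] .
    moreover have "cong2 (Suc n) (S (Suc n)) X" by (rule SX)
    ultimately show ?thesis by (auto simp: cong2_def S_def ord_ge_def)
  qed
  then have eq: "ord_ge (Suc (i + j)) (fst (T X) - fst X)" "ord_ge (Suc (i + j)) (snd (T X) - snd X)" for i j
    by (auto simp: cong2_def)
  have "coeff2 (fst (T X)) i j = coeff2 (fst X) i j" "coeff2 (snd (T X)) i j = coeff2 (snd X) i j" for i j
    using ord_geD[OF eq(1)[of i j], of i j] ord_geD[OF eq(2)[of i j], of i j] by auto
  then have "T X = X" by (intro prod_eqI fps2_eqI)
  with ncX that show ?thesis by blast
qed

section \<open>Linear parts, inverses and the group of formal self-maps\<close>

lemma mem_G2: "F \<in> carrier G2 \<longleftrightarrow> no_const F \<and> invertible (linear_part F)"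
  by (auto simp: G2_def ord_ge_Suc_0_iff)

lemma mult_G2 [simp]: "x \<otimes>\<^bsub>G2\<^esub> y = comp2 x y" and one_G2: "\<one>\<^bsub>G2\<^esub> = (Z1, Z2)"
  by (simp_all add: G2_def)

lemma mat2_eq_iff:
  fixes A B :: "complex^2^2"
  shows "A = B \<longleftrightarrow> A$1$1 = B$1$1 \<and> A$1$2 = B$1$2 \<and> A$2$1 = B$2$1 \<and> A$2$2 = B$2$2"
  by (auto simp: vec_eq_iff forall_2)

lemma linear_part_nth [simp]:
  "linear_part F $ 1 $ 1 = coeff2 (fst F) (Suc 0) 0" "linear_part F $ 1 $ 2 = coeff2 (fst F) 0 (Suc 0)"
  "linear_part F $ 2 $ 1 = coeff2 (snd F) (Suc 0) 0" "linear_part F $ 2 $ 2 = coeff2 (snd F) 0 (Suc 0)"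
  by (simp_all add: linear_part_def vector_2)

lemma coeff2_subst2_linear:
  assumes "no_const G" "m + n = 1"
  shows "coeff2 (subst2 f G) m n = coeff2 f 1 0 * coeff2 (fst G) m n + coeff2 f 0 1 * coeff2 (snd G) m n"
proof -
  have t: "tri 1 = {(0, 0), (1, 0), (0, 1)}" by (auto simp: tri_def)
  have "coeff2 1 m n = 0" using assms(2) by (auto simp: coeff2_1)
  then show ?thesis
    using assms(2) unfolding coeff2_subst2_raw assms(2) t by simp
qed

lemma linear_part_comp2:
  assumes "no_const G"
  shows "linear_part (comp2 F G) = linear_part F ** linear_part G"
  by (simp add: mat2_eq_iff matrix_matrix_mult_def sum_2 coeff2_subst2_linear[OF assms])

lemma linear_part_id: "linear_part (Z1, Z2) = mat 1"
  by (simp add: mat2_eq_iff mat_def coeff2_Z1 coeff2_Z2)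

definition linear_germ :: "complex^2^2 \<Rightarrow> fps2 \<times> fps2" where
  "linear_germ M = (const2 (M$1$1) * Z1 + const2 (M$1$2) * Z2, const2 (M$2$1) * Z1 + const2 (M$2$2) * Z2)"

lemma linear_part_linear_germ [simp]: "linear_part (linear_germ M) = M"
  by (simp add: mat2_eq_iff linear_germ_def coeff2_Z1 coeff2_Z2)

lemma no_const_linear_germ: "no_const (linear_germ M)"
  by (simp add: linear_germ_def ord_ge_add ord_ge_const_mult)

lemma const2_add: "const2 (a + b) = const2 a + const2 b"
  by (intro fps2_eqI) (simp add: coeff2_const2)

lemma comp2_linear_germ:
  assumes "no_const G"
  shows "comp2 (linear_germ M) G = (const2 (M$1$1) * fst G + const2 (M$1$2) * snd G,
    const2 (M$2$1) * fst G + const2 (M$2$2) * snd G)"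
  using assms by (simp add: linear_germ_def comp2_def)

lemma comp2_linear_germs: "comp2 (linear_germ M) (linear_germ N) = linear_germ (M ** N)"
  unfolding comp2_linear_germ[OF no_const_linear_germ]
  by (simp add: linear_germ_def matrix_matrix_mult_def sum_2 const2_add const2_mult algebra_simps)

lemma linear_germ_mat_1: "linear_germ (mat 1) = (Z1, Z2)"
proof -
  have "const2 0 = 0" by (intro fps2_eqI) (simp add: coeff2_const2)
  then show ?thesis by (simp add: linear_germ_def mat_def)
qed

definition nonlinear_part :: "fps2 \<times> fps2 \<Rightarrow> fps2 \<times> fps2" where
  "nonlinear_part G = (fst G - fst (linear_germ (linear_part G)), snd G - snd (linear_germ (linear_part G)))"

lemma ord_ge_2_iff: "ord_ge 2 f \<longleftrightarrow> coeff2 f 0 0 = 0 \<and> coeff2 f (Suc 0) 0 = 0 \<and> coeff2 f 0 (Suc 0) = 0"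
proof
  assume f: "coeff2 f 0 0 = 0 \<and> coeff2 f (Suc 0) 0 = 0 \<and> coeff2 f 0 (Suc 0) = 0"
  show "ord_ge 2 f"
    unfolding ord_ge_def
  proof (intro allI impI)
    fix i j :: nat assume "i + j < 2"
    then consider "i = 0" "j = 0" | "i = Suc 0" "j = 0" | "i = 0" "j = Suc 0" by linarith
    then show "coeff2 f i j = 0" by cases (use f in auto)
  qed
qed (simp add: ord_ge_def)

lemma ord_ge_nonlinear_part:
  "no_const G \<Longrightarrow> ord_ge 2 (fst (nonlinear_part G)) \<and> ord_ge 2 (snd (nonlinear_part G))"
  by (simp add: nonlinear_part_def linear_germ_def ord_ge_2_iff ord_ge_Suc_0_iff coeff2_Z1 coeff2_Z2)

lemma comp2_split_linear:
  assumes "no_const K"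
  shows "comp2 (linear_germ (linear_part G)) K =
    (fst (comp2 G K) - subst2 (fst (nonlinear_part G)) K, snd (comp2 G K) - subst2 (snd (nonlinear_part G)) K)"
  by (simp add: nonlinear_part_def comp2_def)

text \<open>With \<open>G = L + g\<close>, the equation \<open>G \<circ> K = id\<close> is the fixed point equation \<open>K = L\<^sup>-\<^sup>1 (id - g \<circ> K)\<close>.\<close>

lemma inverse_germ_equation:
  assumes G: "no_const G"
    and "no_const K" "linear_part G ** M = mat 1" "M ** linear_part G = mat 1"
  shows "comp2 G K = (Z1, Z2) \<longleftrightarrow>
    comp2 (linear_germ M) (Z1 - subst2 (fst (nonlinear_part G)) K, Z2 - subst2 (snd (nonlinear_part G)) K) = K"
    (is "_ \<longleftrightarrow> comp2 _ ?R = K")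
proof -
  let ?L = "linear_germ (linear_part G)" and ?M = "linear_germ M"
  have idK: "comp2 (Z1, Z2) X = X" if "no_const X" for X using that by (simp add: comp2_def)
  have ncR: "no_const ?R"
    using ord_ge_nonlinear_part[OF G] assms(2)
    by (auto intro!: ord_ge_diff ord_ge_subst2 intro: ord_ge_mono)
  have "comp2 G K = (Z1, Z2) \<longleftrightarrow> comp2 ?L K = ?R"
    unfolding comp2_split_linear[OF assms(2)] by (auto simp: prod_eq_iff)
  also have "\<dots> \<longleftrightarrow> comp2 ?M ?R = K"
  proof
    assume *: "comp2 ?L K = ?R"
    have "comp2 ?M (comp2 ?L K) = K"
      by (subst comp2_assoc[symmetric])
         (use assms(2) no_const_linear_germ in \<open>auto simp: comp2_linear_germs assms linear_germ_mat_1 idK\<close>)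
    then show "comp2 ?M ?R = K" using * by simp
  next
    assume *: "comp2 ?M ?R = K"
    have "comp2 ?L (comp2 ?M ?R) = ?R"
      by (subst comp2_assoc[symmetric])
         (use ncR no_const_linear_germ in \<open>auto simp: comp2_linear_germs assms linear_germ_mat_1 idK\<close>)
    then show "comp2 ?L K = ?R" using * by simp
  qed
  finally show ?thesis .
qed

text \<open>The nonlinear part has order two, so the fixed point map of the inverse equation is
  contracting. The solution lies in the group because its linear part is forced to be
  \<open>M\<close>.\<close>

lemma G2_right_inverse:
  assumes "G \<in> carrier G2"
  obtains K where "K \<in> carrier G2" "comp2 G K = (Z1, Z2)"
proof -
  have G: "no_const G" using assms by (simp add: mem_G2)
  obtain M where M: "linear_part G ** M = mat 1" "M ** linear_part G = mat 1"
    using assms by (auto simp: mem_G2 invertible_def)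
  define R where "R K = (Z1 - subst2 (fst (nonlinear_part G)) K, Z2 - subst2 (snd (nonlinear_part G)) K)" for K
  define T where "T K = comp2 (linear_germ M) (R K)" for K
  have ncR: "no_const (R K)" if "no_const K" for K
    using ord_ge_nonlinear_part[OF G] that
    by (auto simp: R_def intro!: ord_ge_diff ord_ge_subst2 intro: ord_ge_mono)
  obtain K where K: "no_const K" "T K = K"
  proof (rule formal_fixed_point[of T])
    show "no_const (T X)" if "no_const X" for X
      unfolding T_def by (intro no_const_comp2 no_const_linear_germ ncR that)
    show "cong2 (Suc n) (T X) (T Y)" if "no_const X" "no_const Y" "cong2 n X Y" for X Y n
    proof -
      have "cong2 (Suc n) (R Y) (R X)"
        using cong2_subst2[OF _ that(3,1,2)] ord_ge_nonlinear_part[OF G]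
        by (auto simp: R_def cong2_def)
      then show ?thesis
        unfolding T_def comp2_linear_germ[OF ncR[OF that(1)]] comp2_linear_germ[OF ncR[OF that(2)]]
        by (auto simp: cong2_def ord_ge_def)
    qed
  qed
  have GK: "comp2 G K = (Z1, Z2)"
    using inverse_germ_equation[OF G K(1) M] K(2) by (simp add: T_def R_def)
  then have "linear_part G ** linear_part K = mat 1"
    using linear_part_comp2[OF K(1), of G] by (simp add: linear_part_id)
  then have "linear_part K = M"
    by (metis M(2) matrix_mul_assoc matrix_mul_lid matrix_mul_rid)
  then have "K \<in> carrier G2" using M K(1) by (auto simp: mem_G2 invertible_def)
  with GK that show ?thesis by blast
qed

lemma G2_closed: "F \<in> carrier G2 \<Longrightarrow> G \<in> carrier G2 \<Longrightarrow> comp2 F G \<in> carrier G2"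
  by (simp add: mem_G2 ord_ge_subst2 linear_part_comp2 invertible_mult)

lemma id_mem_G2: "(Z1, Z2) \<in> carrier G2"
  by (auto simp: mem_G2 linear_part_id invertible_def)

lemma comp2_id [simp]: "comp2 F (Z1, Z2) = F"
  by (simp add: comp2_def)

lemma id_comp2: "no_const F \<Longrightarrow> comp2 (Z1, Z2) F = F"
  by (simp add: comp2_def)

lemma group_G2: "group G2"
proof (rule groupI)
  \<comment> \<open>Right inverses suffice: if \<open>x y = 1\<close> and \<open>y z = 1\<close>,
    then \<open>z = (x y) z = x (y z) = x\<close>, so \<open>y\<close> is also a left inverse of
    \<open>x\<close>.\<close>
  fix x assume x: "x \<in> carrier G2"
  obtain y where y: "y \<in> carrier G2" "comp2 x y = (Z1, Z2)" using G2_right_inverse[OF x] .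
  obtain z where z: "z \<in> carrier G2" "comp2 y z = (Z1, Z2)" using G2_right_inverse[OF y(1)] .
  have "comp2 (comp2 x y) z = comp2 x (comp2 y z)"
    using y z by (intro comp2_assoc) (auto simp: mem_G2)
  then have "z = x" using y z by (simp add: id_comp2 mem_G2)
  then show "\<exists>y\<in>carrier G2. y \<otimes>\<^bsub>G2\<^esub> x = \<one>\<^bsub>G2\<^esub>"
    using y z by (auto simp: one_G2)
qed (auto simp: one_G2 G2_closed id_mem_G2 comp2_assoc id_comp2 mem_G2[THEN iffD1])

interpretation G2: group G2
  by (rule group_G2)

section \<open>Truncated weighted norms and convergence\<close>

text \<open>The weighted \<open>l1\<close> norm of a Taylor polynomial. It is finite for divergent
  series too, so it can be estimated before convergence is known.\<close>

definition nrm :: "real \<Rightarrow> nat \<Rightarrow> fps2 \<Rightarrow> real" where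
  "nrm r n f = (\<Sum>(i, j)\<in>tri n. cmod (coeff2 f i j) * r ^ (i + j))"

lemma nrm_nonneg [simp]: "0 \<le> r \<Longrightarrow> 0 \<le> nrm r n f"
  unfolding nrm_def by (intro sum_nonneg) auto

lemma nrm_mono: "0 \<le> r \<Longrightarrow> m \<le> n \<Longrightarrow> nrm r m f \<le> nrm r n f"
  unfolding nrm_def by (intro sum_mono2 tri_mono) auto

lemma nrm_add: "0 \<le> r \<Longrightarrow> nrm r n (f + g) \<le> nrm r n f + nrm r n g"
  unfolding nrm_def sum.distrib[symmetric]
  by (intro sum_mono) (auto simp: distrib_right[symmetric] intro!: mult_right_mono norm_triangle_ineq)

lemma nrm_uminus [simp]: "nrm r n (- f) = nrm r n f"
  by (simp add: nrm_def)

lemma nrm_diff: "0 \<le> r \<Longrightarrow> nrm r n (f - g) \<le> nrm r n f + nrm r n g"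
  using nrm_add[of r n f "- g"] by simp

lemma nrm_const_mult [simp]: "nrm r n (const2 c * f) = cmod c * nrm r n f"
  by (simp add: nrm_def sum_distrib_left norm_mult split_def mult.assoc)

lemma nrm_one [simp]: "nrm r n 1 = 1"
proof -
  have "nrm r n 1 = (\<Sum>x\<in>tri n. if x = (0, 0) then 1 else 0)"
    unfolding nrm_def by (intro sum.cong) (auto simp: coeff2_1 split: if_splits)
  then show ?thesis by simp
qed

lemma nrm_0 [simp]: "nrm r n 0 = 0"
  by (simp add: nrm_def)

lemma nrm_trunc_0: "ord_ge (Suc 0) f \<Longrightarrow> nrm r 0 f = 0"
  by (auto simp: nrm_def ord_ge_def intro!: sum.neutral)

text \<open>As \<open>g\<close> starts at order \<open>t\<close>, only the degrees of
  \<open>f\<close> up to \<open>n - t\<close> reach degree \<open>n\<close> of the product, and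
  likewise for \<open>g\<close>.\<close>

lemma nrm_mult_ord:
  assumes r: "0 \<le> r" and f: "ord_ge s f" and g: "ord_ge t g"
  shows "nrm r n (f * g) \<le> nrm r (n - t) f * nrm r (n - s) g"
proof -
  let ?h = "\<lambda>a b c d. (cmod (coeff2 f a b) * r ^ (a + b)) * (cmod (coeff2 g c d) * r ^ (c + d))"
  have "nrm r n (f * g) \<le> (\<Sum>(i, j)\<in>tri n. \<Sum>(a, b)\<in>{..i} \<times> {..j}. ?h a b (i - a) (j - b))"
    unfolding nrm_def
  proof (rule sum_mono)
    fix p assume "p \<in> tri n"
    obtain i j where p: "p = (i, j)" by (cases p)
    have "cmod (coeff2 (f * g) i j) * r ^ (i + j)
        \<le> (\<Sum>(a, b)\<in>{..i} \<times> {..j}. cmod (coeff2 f a b * coeff2 g (i - a) (j - b))) * r ^ (i + j)"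
      unfolding coeff2_mult using r by (intro mult_right_mono) (auto simp: split_def intro: norm_sum)
    also have "\<dots> = (\<Sum>(a, b)\<in>{..i} \<times> {..j}. ?h a b (i - a) (j - b))"
      unfolding sum_distrib_right
    proof (rule sum.cong[OF refl])
      fix q assume "q \<in> {..i} \<times> {..j}"
      then obtain a b where q: "q = (a, b)" "a \<le> i" "b \<le> j" by auto
      then have "r ^ (i + j) = r ^ (a + b) * r ^ ((i - a) + (j - b))"
        by (simp add: power_add[symmetric])
      then show "(case q of (a, b) \<Rightarrow> cmod (coeff2 f a b * coeff2 g (i - a) (j - b))) * r ^ (i + j)
        = (case q of (a, b) \<Rightarrow> ?h a b (i - a) (j - b))"
        by (simp only: q norm_mult prod.case mult_ac)
    qed
    finally show "(case p of (i, j) \<Rightarrow> cmod (coeff2 (f * g) i j) * r ^ (i + j))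
      \<le> (case p of (i, j) \<Rightarrow> \<Sum>(a, b)\<in>{..i} \<times> {..j}. ?h a b (i - a) (j - b))"
      by (simp add: p)
  qed
  also have "\<dots> = (\<Sum>((a, b), (c, d))\<in>tri2 n. ?h a b c d)"
    by (rule sum_tri_convolution)
  also have "\<dots> \<le> (\<Sum>((a, b), (c, d))\<in>tri (n - t) \<times> tri (n - s). ?h a b c d)"
  proof -
    have "(\<Sum>((a, b), (c, d))\<in>tri2 n. ?h a b c d)
        = (\<Sum>((a, b), (c, d))\<in>tri2 n \<inter> (tri (n - t) \<times> tri (n - s)). ?h a b c d)"
    proof (rule sum.mono_neutral_right)
      show "\<forall>x\<in>tri2 n - tri2 n \<inter> (tri (n - t) \<times> tri (n - s)). (\<lambda>((a, b), (c, d)). ?h a b c d) x = 0"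
      proof
        fix x assume x: "x \<in> tri2 n - tri2 n \<inter> (tri (n - t) \<times> tri (n - s))"
        obtain a b c d where abcd: "x = ((a, b), (c, d))" by (metis surj_pair)
        have "a + b < s \<or> c + d < t" using x by (auto simp: abcd tri2_def)
        then show "(\<lambda>((a, b), (c, d)). ?h a b c d) x = 0"
          using f g by (auto simp: abcd ord_ge_def)
      qed
    qed auto
    also have "\<dots> \<le> (\<Sum>((a, b), (c, d))\<in>tri (n - t) \<times> tri (n - s). ?h a b c d)"
      using r by (intro sum_mono2) auto
    finally show ?thesis .
  qed
  also have "\<dots> = nrm r (n - t) f * nrm r (n - s) g"
    by (simp add: nrm_def sum_product sum.cartesian_product split_def)
  finally show ?thesis .
qed

lemma nrm_mult: "0 \<le> r \<Longrightarrow> nrm r n (f * g) \<le> nrm r n f * nrm r n g"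
  using nrm_mult_ord[of r 0 f 0 g n] by simp

lemma nrm_power: "0 \<le> r \<Longrightarrow> nrm r n (f ^ i) \<le> nrm r n f ^ i"
proof (induction i)
  case (Suc i)
  then have "nrm r n (f ^ Suc i) \<le> nrm r n f * nrm r n (f ^ i)"
    using nrm_mult by simp
  also have "\<dots> \<le> nrm r n f * nrm r n f ^ i"
    using Suc by (intro mult_left_mono) auto
  finally show ?case by simp
qed simp

lemma nrm_monom:
  assumes "0 \<le> r" "nrm r n (fst G) \<le> R" "nrm r n (snd G) \<le> R"
  shows "nrm r n (monom2 G i j) \<le> R ^ (i + j)"
proof -
  have "0 \<le> R" using order_trans[OF nrm_nonneg assms(2)] assms(1) by simp
  have "nrm r n (monom2 G i j) \<le> nrm r n (fst G) ^ i * nrm r n (snd G) ^ j"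
    using assms by (intro order_trans[OF nrm_mult] mult_mono nrm_power) auto
  also have "\<dots> \<le> R ^ i * R ^ j"
    using assms \<open>0 \<le> R\<close> by (intro mult_mono power_mono) auto
  finally show ?thesis by (simp add: power_add)
qed

text \<open>A product of two factors without constant term gains one degree.\<close>

lemma nrm_monom_pred:
  assumes r: "0 \<le> r" and G: "no_const G" and ij: "2 \<le> i + j"
    and R: "nrm r (n - 1) (fst G) \<le> R" "nrm r (n - 1) (snd G) \<le> R"
  shows "nrm r n (monom2 G i j) \<le> R ^ (i + j)"
proof -
  have R0: "0 \<le> R" using order_trans[OF nrm_nonneg R(1)] r by simp
  have gain: "nrm r n (h * monom2 G a b) \<le> R ^ Suc (a + b)"
    if "ord_ge (Suc 0) h" "nrm r (n - 1) h \<le> R" "1 \<le> a + b" for h a b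
  proof -
    have "ord_ge (Suc 0) (monom2 G a b)"
      using G that by (intro ord_ge_mono[OF ord_ge_monom[of _ _ a b]]) auto
    then have "nrm r n (h * monom2 G a b) \<le> nrm r (n - 1) h * nrm r (n - 1) (monom2 G a b)"
      using nrm_mult_ord[OF r that(1), of "Suc 0" "monom2 G a b" n] by simp
    also have "\<dots> \<le> R * R ^ (a + b)"
      using that R R0 r by (intro mult_mono nrm_monom) auto
    finally show ?thesis by simp
  qed
  show ?thesis
  proof (cases i)
    case (Suc a)
    then show ?thesis using gain[of "fst G" a j] G R ij by (simp add: mult.assoc)
  next
    case 0
    then obtain b where "j = Suc b" "1 \<le> b" using ij by (cases j) auto
    with 0 show ?thesis using gain[of "snd G" 0 b] G R by simp
  qed
qed

lemma nrm_sum_le: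
  assumes "0 \<le> r"
  shows "nrm r n (sum f A) \<le> (\<Sum>a\<in>A. nrm r n (f a))"
proof (induction A rule: infinite_finite_induct)
  case (insert x A)
  then show ?case using nrm_add[OF assms, of n "f x" "sum f A"] by simp
qed simp_all

lemma nrm_cong:
  assumes "\<And>i j. i + j \<le> n \<Longrightarrow> coeff2 f i j = coeff2 g i j"
  shows "nrm r n f = nrm r n g"
  unfolding nrm_def by (intro sum.cong) (auto simp: assms)

text \<open>Majorant principle: each monomial in \<open>G\<close> is replaced by the number
  \<open>R ^ (i + j)\<close>. Only monomials occurring in \<open>f\<close> need a bound, so a series
  of order two can exploit the gain of one degree.\<close>

lemma nrm_subst2_bound:
  assumes r: "0 \<le> r" and G: "no_const G"
    and bound: "\<And>i j. coeff2 f i j \<noteq> 0 \<Longrightarrow> nrm r n (monom2 G i j) \<le> R ^ (i + j)"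
  shows "nrm r n (subst2 f G) \<le> nrm R n f"
proof -
  have "nrm r n (subst2 f G) = nrm r n (\<Sum>(i, j)\<in>tri n. const2 (coeff2 f i j) * monom2 G i j)"
    by (intro nrm_cong) (simp add: coeff2_sum split_def coeff2_subst2[OF G])
  also have "\<dots> \<le> (\<Sum>(i, j)\<in>tri n. nrm r n (const2 (coeff2 f i j) * monom2 G i j))"
    unfolding split_def by (rule nrm_sum_le[OF r])
  also have "\<dots> \<le> nrm R n f"
    unfolding nrm_def[of R]
  proof (rule sum_mono)
    fix p assume "p \<in> tri n"
    obtain i j where p: "p = (i, j)" by (cases p)
    show "(case p of (i, j) \<Rightarrow> nrm r n (const2 (coeff2 f i j) * monom2 G i j))
        \<le> (case p of (i, j) \<Rightarrow> cmod (coeff2 f i j) * R ^ (i + j))"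
      using bound[of i j] by (cases "coeff2 f i j = 0") (auto simp: p intro: mult_left_mono)
  qed
  finally show ?thesis .
qed

lemma nrm_subst2:
  assumes "0 \<le> r" "no_const G" "nrm r n (fst G) \<le> R" "nrm r n (snd G) \<le> R"
  shows "nrm r n (subst2 f G) \<le> nrm R n f"
  using assms by (intro nrm_subst2_bound nrm_monom)

text \<open>This drives the inductions on the degree for fixed point equations: \<open>f\<close> has
  no monomial of degree below two, and all others gain a degree.\<close>

lemma nrm_subst2_pred:
  assumes "0 \<le> r" "no_const G" "ord_ge 2 f" "nrm r (n - 1) (fst G) \<le> R" "nrm r (n - 1) (snd G) \<le> R"
  shows "nrm r n (subst2 f G) \<le> nrm R n f"
proof (intro nrm_subst2_bound assms(1,2))
  fix i j assume "coeff2 f i j \<noteq> 0"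
  then have "2 \<le> i + j" using assms(3) by (meson not_le ord_geD)
  then show "nrm r n (monom2 G i j) \<le> R ^ (i + j)"
    using assms by (intro nrm_monom_pred)
qed

lemma nrm_scale:
  assumes "ord_ge s f" "0 \<le> t" "t \<le> 1" "0 \<le> r"
  shows "nrm (t * r) n f \<le> t ^ s * nrm r n f"
  unfolding nrm_def sum_distrib_left
proof (rule sum_mono)
  fix p assume "p \<in> tri n"
  obtain i j where p: "p = (i, j)" by (cases p)
  show "(case p of (i, j) \<Rightarrow> cmod (coeff2 f i j) * (t * r) ^ (i + j))
      \<le> t ^ s * (case p of (i, j) \<Rightarrow> cmod (coeff2 f i j) * r ^ (i + j))"
  proof (cases "i + j < s")
    case False
    then have "t ^ (i + j) \<le> t ^ s" using assms by (intro power_decreasing) auto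
    then have "t ^ (i + j) * (cmod (coeff2 f i j) * r ^ (i + j)) \<le> t ^ s * (cmod (coeff2 f i j) * r ^ (i + j))"
      using assms by (intro mult_right_mono) auto
    then show ?thesis by (simp add: p power_mult_distrib mult_ac)
  qed (use assms(1) in \<open>simp add: p ord_geD\<close>)
qed

lemma nrm_Z1_mult: "nrm r (Suc n) (Z1 * f) = r * nrm r n f"
  unfolding nrm_def sum_distrib_left
proof -
  have "(\<Sum>(i, j)\<in>tri (Suc n). cmod (coeff2 (Z1 * f) i j) * r ^ (i + j))
    = (\<Sum>(i, j)\<in>(\<lambda>(i, j). (Suc i, j)) ` tri n. cmod (coeff2 (Z1 * f) i j) * r ^ (i + j))"
  proof (rule sum.mono_neutral_right)
    show "\<forall>x\<in>tri (Suc n) - (\<lambda>(i, j). (Suc i, j)) ` tri n. (case x of (i, j) \<Rightarrow> cmod (coeff2 (Z1 * f) i j) * r ^ (i + j)) = 0"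
    proof
      fix x assume x: "x \<in> tri (Suc n) - (\<lambda>(i, j). (Suc i, j)) ` tri n"
      obtain i j where ij: "x = (i, j)" by (cases x)
      show "(case x of (i, j) \<Rightarrow> cmod (coeff2 (Z1 * f) i j) * r ^ (i + j)) = 0"
      proof (cases i)
        case (Suc a)
        then have "(a, j) \<in> tri n" using x ij by simp
        then have "(\<lambda>(i, j). (Suc i, j)) (a, j) \<in> (\<lambda>(i, j). (Suc i, j)) ` tri n" by (rule imageI)
        then show ?thesis using x ij Suc by simp
      qed (simp add: ij coeff2_Z1_mult)
    qed
  qed auto
  also have "\<dots> = (\<Sum>x\<in>tri n. r * (case x of (i, j) \<Rightarrow> cmod (coeff2 f i j) * r ^ (i + j)))"
    by (subst sum.reindex) (auto simp: inj_on_def coeff2_Z1_mult split_def mult_ac intro!: sum.cong)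
  finally show "(\<Sum>(i, j)\<in>tri (Suc n). cmod (coeff2 (Z1 * f) i j) * r ^ (i + j))
    = (\<Sum>x\<in>tri n. r * (case x of (i, j) \<Rightarrow> cmod (coeff2 f i j) * r ^ (i + j)))" .
qed

lemma nrm_Z2_mult: "nrm r (Suc n) (Z2 * f) = r * nrm r n f"
  unfolding nrm_def sum_distrib_left
proof -
  have "(\<Sum>(i, j)\<in>tri (Suc n). cmod (coeff2 (Z2 * f) i j) * r ^ (i + j))
    = (\<Sum>(i, j)\<in>(\<lambda>(i, j). (i, Suc j)) ` tri n. cmod (coeff2 (Z2 * f) i j) * r ^ (i + j))"
  proof (rule sum.mono_neutral_right)
    show "\<forall>x\<in>tri (Suc n) - (\<lambda>(i, j). (i, Suc j)) ` tri n. (case x of (i, j) \<Rightarrow> cmod (coeff2 (Z2 * f) i j) * r ^ (i + j)) = 0"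
    proof
      fix x assume x: "x \<in> tri (Suc n) - (\<lambda>(i, j). (i, Suc j)) ` tri n"
      obtain i j where ij: "x = (i, j)" by (cases x)
      show "(case x of (i, j) \<Rightarrow> cmod (coeff2 (Z2 * f) i j) * r ^ (i + j)) = 0"
      proof (cases j)
        case (Suc a)
        then have "(i, a) \<in> tri n" using x ij by simp
        then have "(\<lambda>(i, j). (i, Suc j)) (i, a) \<in> (\<lambda>(i, j). (i, Suc j)) ` tri n" by (rule imageI)
        then show ?thesis using x ij Suc by simp
      qed (simp add: ij coeff2_Z2_mult)
    qed
  qed auto
  also have "\<dots> = (\<Sum>x\<in>tri n. r * (case x of (i, j) \<Rightarrow> cmod (coeff2 f i j) * r ^ (i + j)))"
    by (subst sum.reindex) (auto simp: inj_on_def coeff2_Z2_mult split_def mult_ac intro!: sum.cong)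
  finally show "(\<Sum>(i, j)\<in>tri (Suc n). cmod (coeff2 (Z2 * f) i j) * r ^ (i + j))
    = (\<Sum>x\<in>tri n. r * (case x of (i, j) \<Rightarrow> cmod (coeff2 f i j) * r ^ (i + j)))" .
qed

lemma nrm_Z1: "0 \<le> r \<Longrightarrow> nrm r n Z1 \<le> r" and nrm_Z2: "0 \<le> r \<Longrightarrow> nrm r n Z2 \<le> r"
  using nrm_mono[of r n "Suc n" Z1] nrm_mono[of r n "Suc n" Z2] nrm_Z1_mult[of r n 1] nrm_Z2_mult[of r n 1]
  by simp_all

section \<open>Convergent series and closure properties of biholomorphic germs\<close>

lemma convergent2_iff_nrm:
  "convergent2 f \<longleftrightarrow> (\<exists>r>0. \<exists>B. \<forall>n. nrm r n f \<le> B)"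
proof
  assume "convergent2 f"
  then obtain r where r: "r > 0" "\<And>z1 z2. cmod z1 < r \<Longrightarrow> cmod z2 < r \<Longrightarrow>
     (\<lambda>(i, j). coeff2 f i j * z1 ^ i * z2 ^ j) summable_on UNIV"
    unfolding convergent2_def by blast
  \<comment> \<open>At a diagonal point with positive coordinates the moduli of the terms are
    exactly the summands of the norm.\<close>
  let ?z = "complex_of_real (r / 2)"
  let ?t = "\<lambda>(i, j). coeff2 f i j * ?z ^ i * ?z ^ j"
  have "?t summable_on UNIV" using r by (intro r(2)) auto
  then have abs: "(\<lambda>x. cmod (?t x)) summable_on UNIV"
    by (simp add: summable_on_iff_abs_summable_on_complex)
  have "nrm (r / 2) n f \<le> infsum (\<lambda>x. cmod (?t x)) UNIV" for n
  proof -
    have "nrm (r / 2) n f = (\<Sum>x\<in>tri n. cmod (?t x))"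
      unfolding nrm_def using r by (intro sum.cong) (auto simp: norm_mult norm_power power_add)
    also have "\<dots> \<le> infsum (\<lambda>x. cmod (?t x)) UNIV"
      by (rule finite_sum_le_infsum[OF abs]) auto
    finally show ?thesis .
  qed
  then show "\<exists>r>0. \<exists>B. \<forall>n. nrm r n f \<le> B" using r(1) half_gt_zero by blast
next
  assume "\<exists>r>0. \<exists>B. \<forall>n. nrm r n f \<le> B"
  then obtain r B where r: "r > 0" "\<And>n. nrm r n f \<le> B" by blast
  show "convergent2 f"
    unfolding convergent2_def
  proof (intro exI[of _ r] conjI allI impI r(1))
    fix z1 z2 assume z: "cmod z1 < r" "cmod z2 < r"
    let ?t = "\<lambda>(i, j). coeff2 f i j * z1 ^ i * z2 ^ j"
    have "(\<lambda>x. cmod (?t x)) summable_on UNIV"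
    proof (rule nonneg_bdd_above_summable_on)
      show "bdd_above (sum (\<lambda>x. cmod (?t x)) ` {F. F \<subseteq> UNIV \<and> finite F})"
      proof (rule bdd_aboveI2)
        fix F :: "(nat \<times> nat) set" assume "F \<in> {F. F \<subseteq> UNIV \<and> finite F}"
        then have F: "finite F" by simp
        define n where "n = Max (insert 0 ((\<lambda>(i, j). i + j) ` F))"
        have sub: "F \<subseteq> tri n"
        proof
          fix x assume x: "x \<in> F"
          obtain i j where ij: "x = (i, j)" by (cases x)
          have "i + j \<le> n" unfolding n_def using F x ij by (intro Max_ge) (auto intro: rev_image_eqI)
          then show "x \<in> tri n" by (simp add: ij)
        qed
        have "sum (\<lambda>x. cmod (?t x)) F \<le> sum (\<lambda>x. cmod (?t x)) (tri n)"
          using sub by (intro sum_mono2) auto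
        also have "\<dots> \<le> nrm r n f"
          unfolding nrm_def
          using z r(1) by (intro sum_mono)
             (auto simp: norm_mult norm_power power_add mult.assoc intro!: mult_left_mono mult_mono power_mono)
        also have "\<dots> \<le> B" by (rule r(2))
        finally show "sum (\<lambda>x. cmod (?t x)) F \<le> B" .
      qed
    qed auto
    then show "?t summable_on UNIV"
      by (simp add: summable_on_iff_abs_summable_on_complex)
  qed
qed

text \<open>Shrinking the radius from \<open>R\<close> to \<open>r\<close> gains the factor
  \<open>(r / R) ^ s\<close>. The constant is built from \<open>B + 1\<close> to make it
  positive.\<close>

lemma convergent2_small:
  assumes "convergent2 f" "ord_ge s f"
  obtains C R where "R > 0" "C > 0" "\<And>r n. 0 \<le> r \<Longrightarrow> r \<le> R \<Longrightarrow> nrm r n f \<le> C * r ^ s"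
proof -
  obtain R B where R: "R > 0" "\<And>n. nrm R n f \<le> B"
    using assms(1) convergent2_iff_nrm by blast
  have B: "0 \<le> B" using order_trans[OF nrm_nonneg R(2)] R(1) by auto
  have "nrm r n f \<le> (B + 1) / R ^ s * r ^ s" if "0 \<le> r" "r \<le> R" for r n
  proof -
    have "nrm r n f = nrm (r / R * R) n f" using R by simp
    also have "\<dots> \<le> (r / R) ^ s * nrm R n f"
      using that R by (intro nrm_scale assms) auto
    also have "\<dots> \<le> (r / R) ^ s * (B + 1)"
      using that R(1) add_increasing2[OF zero_le_one R(2)[of n]] by (intro mult_left_mono) auto
    finally show ?thesis by (simp add: power_divide mult_ac)
  qed
  then show ?thesis using that[of R "(B + 1) / R ^ s"] R B by auto
qed

lemma convergent2_bound:
  assumes "0 < r" "\<And>n. nrm r n f \<le> B"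
  shows "convergent2 f"
  using assms convergent2_iff_nrm by blast

lemma convergent2_bounded:
  assumes "convergent2 f"
  obtains C R where "R > 0" "C > 0" "\<And>r n. 0 \<le> r \<Longrightarrow> r \<le> R \<Longrightarrow> nrm r n f \<le> C"
  using convergent2_small[OF assms ord_ge_0] by (metis mult.right_neutral power_0)

lemma convergent2_diff:
  assumes "convergent2 f" "convergent2 g"
  shows "convergent2 (f - g)"
proof -
  obtain A R where A: "R > 0" "\<And>r n. 0 \<le> r \<Longrightarrow> r \<le> R \<Longrightarrow> nrm r n f \<le> A"
    using convergent2_bounded[OF assms(1)] by metis
  obtain B S where B: "S > 0" "\<And>r n. 0 \<le> r \<Longrightarrow> r \<le> S \<Longrightarrow> nrm r n g \<le> B"
    using convergent2_bounded[OF assms(2)] by metis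
  have "nrm (min R S) n (f - g) \<le> A + B" for n
    using A B by (intro order_trans[OF nrm_diff] add_mono) auto
  then show ?thesis using A(1) B(1) by (intro convergent2_bound[of "min R S"]) auto
qed

lemma convergent2_mult:
  assumes "convergent2 f" "convergent2 g"
  shows "convergent2 (f * g)"
proof -
  obtain A R where A: "R > 0" "A > 0" "\<And>r n. 0 \<le> r \<Longrightarrow> r \<le> R \<Longrightarrow> nrm r n f \<le> A"
    using convergent2_bounded[OF assms(1)] by metis
  obtain B S where B: "S > 0" "\<And>r n. 0 \<le> r \<Longrightarrow> r \<le> S \<Longrightarrow> nrm r n g \<le> B"
    using convergent2_bounded[OF assms(2)] by metis
  have "nrm (min R S) n (f * g) \<le> A * B" for n
    using A B by (intro order_trans[OF nrm_mult] mult_mono) auto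
  then show ?thesis using A(1) B(1) by (intro convergent2_bound[of "min R S"]) auto
qed

lemma convergent2_Z1: "convergent2 Z1" and convergent2_Z2: "convergent2 Z2"
  by (auto intro!: convergent2_bound[of 1] nrm_Z1 nrm_Z2)

lemma convergent2_linear_germ:
  "convergent2 (fst (linear_germ M))" "convergent2 (snd (linear_germ M))"
proof -
  have "nrm 1 n (const2 a * Z1 + const2 b * Z2) \<le> cmod a + cmod b" for a b n
  proof -
    have "nrm 1 n (const2 a * Z1 + const2 b * Z2) \<le> cmod a * nrm 1 n Z1 + cmod b * nrm 1 n Z2"
      using nrm_add[of 1 n "const2 a * Z1" "const2 b * Z2"] by simp
    also have "\<dots> \<le> cmod a * 1 + cmod b * 1"
      by (intro add_mono mult_left_mono nrm_Z1 nrm_Z2) auto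
    finally show ?thesis by simp
  qed
  then show "convergent2 (fst (linear_germ M))" "convergent2 (snd (linear_germ M))"
    by (auto simp: linear_germ_def intro!: convergent2_bound[of 1])
qed

lemma convergent2_subst2:
  assumes f: "convergent2 f" and G: "no_const G" "convergent2 (fst G)" "convergent2 (snd G)"
  shows "convergent2 (subst2 f G)"
proof -
  obtain B S where B: "S > 0" "\<And>r n. 0 \<le> r \<Longrightarrow> r \<le> S \<Longrightarrow> nrm r n f \<le> B"
    using convergent2_bounded[OF f] by metis
  obtain C1 R1 where 1: "R1 > 0" "C1 > 0" "\<And>r n. 0 \<le> r \<Longrightarrow> r \<le> R1 \<Longrightarrow> nrm r n (fst G) \<le> C1 * r ^ Suc 0"
    using convergent2_small[of "fst G" "Suc 0"] G by metis
  obtain C2 R2 where 2: "R2 > 0" "C2 > 0" "\<And>r n. 0 \<le> r \<Longrightarrow> r \<le> R2 \<Longrightarrow> nrm r n (snd G) \<le> C2 * r ^ Suc 0"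
    using convergent2_small[of "snd G" "Suc 0"] G by metis
  define r where "r = min (min R1 R2) (min (S / C1) (S / C2))"
  have r: "r > 0" using B 1 2 by (simp add: r_def)
  have "r \<le> R1" "r \<le> R2" "r \<le> S / C1" "r \<le> S / C2" by (auto simp: r_def)
  then have "C1 * r \<le> S" "C2 * r \<le> S" using 1 2 by (auto simp: field_simps)
  then have "nrm r n (fst G) \<le> S" "nrm r n (snd G) \<le> S" for n
    using 1(3)[of r n] 2(3)[of r n] r \<open>r \<le> R1\<close> \<open>r \<le> R2\<close> by auto
  then have "nrm r n (subst2 f G) \<le> nrm S n f" for n
    using G r by (intro nrm_subst2) auto
  also have "nrm S n f \<le> B" for n using B by auto
  finally show ?thesis using r by (intro convergent2_bound)
qed

lemma nrm_linear_combination: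
  assumes "0 \<le> r" "nrm r n f \<le> X" "nrm r n g \<le> X" "cmod a + cmod b \<le> \<beta>"
  shows "nrm r n (const2 a * f + const2 b * g) \<le> \<beta> * X"
proof -
  have X: "0 \<le> X" using order_trans[OF nrm_nonneg assms(2)] assms(1) by simp
  have "nrm r n (const2 a * f + const2 b * g) \<le> cmod a * nrm r n f + cmod b * nrm r n g"
    using nrm_add[OF assms(1), of n "const2 a * f" "const2 b * g"] by simp
  also have "\<dots> \<le> cmod a * X + cmod b * X"
    by (intro add_mono mult_left_mono assms) auto
  also have "\<dots> \<le> \<beta> * X"
    using mult_right_mono[OF assms(4) X] by (simp add: algebra_simps)
  finally show ?thesis .
qed

text \<open>The equation \<open>K = M (id - g(K))\<close> with \<open>g\<close> of order two bounds
  \<open>K\<close> at degree \<open>n + 1\<close> through degree \<open>n\<close>; for a small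
  radius the bound reproduces itself.\<close>

lemma convergent2_inverse:
  assumes G: "no_const G" "convergent2 (fst G)" "convergent2 (snd G)"
    and M: "linear_part G ** M = mat 1" "M ** linear_part G = mat 1"
    and K: "no_const K" "comp2 G K = (Z1, Z2)"
  shows "convergent2 (fst K)" "convergent2 (snd K)"
proof -
  let ?g1 = "fst (nonlinear_part G)" and ?g2 = "snd (nonlinear_part G)"
  have o: "ord_ge 2 ?g1" "ord_ge 2 ?g2" using ord_ge_nonlinear_part[OF G(1)] by auto
  have c: "convergent2 ?g1" "convergent2 ?g2"
    using G convergent2_linear_germ by (auto simp: nonlinear_part_def intro: convergent2_diff)
  obtain C1 R1 where 1: "R1 > 0" "C1 > 0" "\<And>r n. 0 \<le> r \<Longrightarrow> r \<le> R1 \<Longrightarrow> nrm r n ?g1 \<le> C1 * r ^ 2"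
    using convergent2_small[OF c(1) o(1)] by metis
  obtain C2 R2 where 2: "R2 > 0" "C2 > 0" "\<And>r n. 0 \<le> r \<Longrightarrow> r \<le> R2 \<Longrightarrow> nrm r n ?g2 \<le> C2 * r ^ 2"
    using convergent2_small[OF c(2) o(2)] by metis
  define C where "C = max C1 C2"
  have C: "C > 0" "\<And>r n. 0 \<le> r \<Longrightarrow> r \<le> min R1 R2 \<Longrightarrow> nrm r n ?g1 \<le> C * r ^ 2"
    "\<And>r n. 0 \<le> r \<Longrightarrow> r \<le> min R1 R2 \<Longrightarrow> nrm r n ?g2 \<le> C * r ^ 2"
  proof -
    have "C1 * r ^ 2 \<le> C * r ^ 2" "C2 * r ^ 2 \<le> C * r ^ 2" for r
      by (auto simp: C_def intro!: mult_right_mono)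
    then show "\<And>r n. 0 \<le> r \<Longrightarrow> r \<le> min R1 R2 \<Longrightarrow> nrm r n ?g1 \<le> C * r ^ 2"
      "\<And>r n. 0 \<le> r \<Longrightarrow> r \<le> min R1 R2 \<Longrightarrow> nrm r n ?g2 \<le> C * r ^ 2"
      using 1(3) 2(3) by (meson min.boundedE order_trans)+
  qed (use 1 in \<open>simp add: C_def\<close>)
  define \<beta> where "\<beta> = 1 + cmod (M$1$1) + cmod (M$1$2) + cmod (M$2$1) + cmod (M$2$2)"
  have \<beta>: "\<beta> \<ge> 1" "cmod (M$1$1) + cmod (M$1$2) \<le> \<beta>" "cmod (M$2$1) + cmod (M$2$2) \<le> \<beta>"
    by (auto simp: \<beta>_def)
  \<comment> \<open>The induction closes with \<open>R = 2 \<beta> r\<close>: the choice of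
    \<open>r\<close> gives \<open>C R\<^sup>2 \<le> r\<close>, hence \<open>X\<close> has norm at
    most \<open>2 r\<close>, and applying \<open>M\<close> costs at most a factor \<beta>.\<close>
  define r where "r = min (min R1 R2 / (2 * \<beta>)) (1 / (4 * C * \<beta>\<^sup>2))"
  define R where "R = 2 * \<beta> * r"
  have r: "r > 0" using 1 2 C \<beta> by (simp add: r_def)
  have R: "0 \<le> R" "R \<le> min R1 R2"
  proof -
    have "r \<le> min R1 R2 / (2 * \<beta>)" by (simp add: r_def)
    then show "R \<le> min R1 R2" using \<beta> by (simp add: R_def field_simps)
  qed (use r \<beta> in \<open>simp add: R_def\<close>)
  have CR: "C * R\<^sup>2 \<le> r"
  proof -
    have "r \<le> 1 / (4 * C * \<beta>\<^sup>2)" by (simp add: r_def)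
    then have "4 * C * \<beta>\<^sup>2 * r \<le> 1" using C \<beta> by (simp add: field_simps)
    then have "(4 * C * \<beta>\<^sup>2 * r) * r \<le> 1 * r" using r by (intro mult_right_mono) auto
    then show ?thesis by (simp add: R_def power2_eq_square mult_ac)
  qed
  define X where "X = (Z1 - subst2 ?g1 K, Z2 - subst2 ?g2 K)"
  have ncX: "no_const X" using o K
    by (auto simp: X_def intro!: ord_ge_diff ord_ge_subst2 intro: ord_ge_mono)
  have "comp2 (linear_germ M) X = K"
    using inverse_germ_equation[OF G(1) K(1) M] K(2) by (simp add: X_def)
  then have K_eq: "fst K = const2 (M$1$1) * fst X + const2 (M$1$2) * snd X"
      "snd K = const2 (M$2$1) * fst X + const2 (M$2$2) * snd X"
    unfolding comp2_linear_germ[OF ncX] by auto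
  have "nrm r n (fst K) \<le> R \<and> nrm r n (snd K) \<le> R" for n
  proof (induction n)
    case 0
    then show ?case using K R by (simp add: nrm_trunc_0)
  next
    case (Suc n)
    have "nrm r (Suc n) (subst2 ?g1 K) \<le> nrm R (Suc n) ?g1" "nrm r (Suc n) (subst2 ?g2 K) \<le> nrm R (Suc n) ?g2"
      using Suc r K o by (auto intro!: nrm_subst2_pred)
    then have "nrm r (Suc n) (subst2 ?g1 K) \<le> r" "nrm r (Suc n) (subst2 ?g2 K) \<le> r"
      using C(2,3)[OF R, of "Suc n"] CR by auto
    then have "nrm r (Suc n) (fst X) \<le> 2 * r" "nrm r (Suc n) (snd X) \<le> 2 * r"
      using r nrm_diff[of r "Suc n" Z1 "subst2 ?g1 K"] nrm_diff[of r "Suc n" Z2 "subst2 ?g2 K"]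
        nrm_Z1[of r "Suc n"] nrm_Z2[of r "Suc n"]
      unfolding X_def fst_conv snd_conv by linarith+
    then have "nrm r (Suc n) (fst K) \<le> \<beta> * (2 * r)" "nrm r (Suc n) (snd K) \<le> \<beta> * (2 * r)"
      unfolding K_eq using r \<beta> by (auto intro!: nrm_linear_combination)
    then show ?case by (simp add: R_def mult_ac)
  qed
  then show "convergent2 (fst K)" "convergent2 (snd K)"
    using r by (auto intro: convergent2_bound)
qed

lemma biholomorphic_germs_closed:
  assumes "F \<in> biholomorphic_germs" "G \<in> biholomorphic_germs"
  shows "comp2 F G \<in> biholomorphic_germs"
  using assms G2_closed
  by (auto simp: biholomorphic_germs_def mem_G2[of G] intro!: convergent2_subst2)

lemma biholomorphic_germs_inv:
  assumes "G \<in> biholomorphic_germs"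
  shows "inv\<^bsub>G2\<^esub> G \<in> biholomorphic_germs"
proof -
  have G: "G \<in> carrier G2" "convergent2 (fst G)" "convergent2 (snd G)"
    using assms by (auto simp: biholomorphic_germs_def)
  let ?K = "inv\<^bsub>G2\<^esub> G"
  have K: "?K \<in> carrier G2" "comp2 G ?K = (Z1, Z2)"
    using G2.inv_closed[OF G(1)] G2.r_inv[OF G(1)] by (auto simp: one_G2)
  obtain M where M: "linear_part G ** M = mat 1" "M ** linear_part G = mat 1"
    using G by (auto simp: mem_G2 invertible_def)
  show ?thesis
    using convergent2_inverse[OF _ G(2,3) M _ K(2)] K(1) G(1)
    by (auto simp: biholomorphic_germs_def mem_G2)
qed

section \<open>Weights\<close>

text \<open>\<open>z\<^sub>1\<^sup>i z\<^sub>2\<^sup>j\<close> has weight \<open>i - j\<close>; the resonant monomials of a first (second) component are those of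
  weight \<open>1\<close> (\<open>-1\<close>).\<close>

definition wt :: "int \<Rightarrow> fps2 \<Rightarrow> bool" where
  "wt d f \<longleftrightarrow> (\<forall>i j. coeff2 f i j \<noteq> 0 \<longrightarrow> int i - int j = d)"

definition wproj :: "int \<Rightarrow> fps2 \<Rightarrow> fps2" where
  "wproj d f = Abs_fps (\<lambda>i. Abs_fps (\<lambda>j. if int i - int j = d then coeff2 f i j else 0))"

lemma coeff2_wproj: "coeff2 (wproj d f) i j = (if int i - int j = d then coeff2 f i j else 0)"
  by (simp add: coeff2_def wproj_def)

lemma wt_wproj: "wt d (wproj d f)"
  by (simp add: wt_def coeff2_wproj)

lemma wproj_add: "wproj d (f + g) = wproj d f + wproj d g"
  by (intro fps2_eqI) (simp add: coeff2_wproj)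

lemma wproj_const_mult: "wproj d (const2 c * f) = const2 c * wproj d f"
  by (intro fps2_eqI) (simp add: coeff2_wproj)

lemma wt_wproj_eq: "wt d f \<Longrightarrow> wproj d f = f"
  by (intro fps2_eqI) (auto simp: coeff2_wproj wt_def)

lemma ord_ge_wproj: "ord_ge s f \<Longrightarrow> ord_ge s (wproj d f)"
  by (simp add: ord_ge_def coeff2_wproj)

lemma wt_mult:
  assumes "wt d f" "wt e g"
  shows "wt (d + e) (f * g)"
  unfolding wt_def
proof (intro allI impI)
  fix i j assume "coeff2 (f * g) i j \<noteq> 0"
  then obtain a b where "a \<le> i" "b \<le> j" "coeff2 f a b * coeff2 g (i - a) (j - b) \<noteq> 0"
    unfolding coeff2_mult by (auto elim!: sum.not_neutral_contains_not_neutral)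
  then have "int a - int b = d" "int (i - a) - int (j - b) = e" "a \<le> i" "b \<le> j"
    using assms unfolding wt_def by (metis mult_eq_0_iff)+
  then show "int i - int j = d + e" by (simp add: of_nat_diff)
qed

lemma wt_Z1: "wt 1 Z1" and wt_Z2: "wt (-1) Z2" and wt_1: "wt 0 1"
  by (auto simp: wt_def coeff2_Z1 coeff2_Z2 coeff2_1 split: if_splits)

lemma wt_power: "wt d f \<Longrightarrow> wt (int n * d) (f ^ n)"
  by (induction n) (auto simp: wt_1 algebra_simps dest: wt_mult)

lemma wt_monom:
  assumes "wt 1 (fst G)" "wt (-1) (snd G)"
  shows "wt (int i - int j) (monom2 G i j)"
  using wt_mult[OF wt_power[OF assms(1), of i] wt_power[OF assms(2), of j]] by simp

text \<open>Inserting components of weights \<open>1\<close> and \<open>-1\<close> keeps the weight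
  of every monomial, so parts of different weight do not mix.\<close>

lemma wproj_subst2:
  assumes "wt 1 (fst G)" "wt (-1) (snd G)"
  shows "wproj d (subst2 f G) = subst2 (wproj d f) G"
proof (intro fps2_eqI)
  fix m n
  have "(if int m - int n = d then coeff2 f i j * coeff2 (monom2 G i j) m n else 0)
      = coeff2 (wproj d f) i j * coeff2 (monom2 G i j) m n" for i j
    using wt_monom[OF assms, of i j] unfolding wt_def coeff2_wproj
    by (cases "coeff2 (monom2 G i j) m n = 0") auto
  then have "coeff2 (subst2 (wproj d f) G) m n
     = (\<Sum>(i, j)\<in>tri (m + n). if int m - int n = d then coeff2 f i j * coeff2 (monom2 G i j) m n else 0)"
    by (simp add: coeff2_subst2_raw)
  then show "coeff2 (wproj d (subst2 f G)) m n = coeff2 (subst2 (wproj d f) G) m n"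
    by (simp add: coeff2_wproj coeff2_subst2_raw)
qed

lemma wt_subst2: "wt 1 (fst G) \<Longrightarrow> wt (-1) (snd G) \<Longrightarrow> wt d f \<Longrightarrow> wt d (subst2 f G)"
  using wproj_subst2[of G d f] wt_wproj[of d "subst2 f G"] by (simp add: wt_wproj_eq)

lemma sum_coeff2_monom_mult:
  assumes "m + n \<le> N"
  shows "(\<Sum>(i, j)\<in>tri N. coeff2 f i j * coeff2 (h * (Z1 ^ i * Z2 ^ j)) m n) = coeff2 (h * f) m n"
proof -
  have "(\<Sum>(i, j)\<in>tri N. coeff2 f i j * coeff2 (h * (Z1 ^ i * Z2 ^ j)) m n)
    = (\<Sum>(i, j)\<in>tri N. \<Sum>(a, b)\<in>{..m} \<times> {..n}. if (i, j) = (m - a, n - b) then coeff2 h a b * coeff2 f i j else 0)"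
  proof (rule sum.cong[OF refl])
    fix p assume "p \<in> tri N"
    obtain i j where p: "p = (i, j)" by (cases p)
    show "(case p of (i, j) \<Rightarrow> coeff2 f i j * coeff2 (h * (Z1 ^ i * Z2 ^ j)) m n)
      = (case p of (i, j) \<Rightarrow> \<Sum>(a, b)\<in>{..m} \<times> {..n}. if (i, j) = (m - a, n - b) then coeff2 h a b * coeff2 f i j else 0)"
      unfolding p prod.case coeff2_mult[of h] sum_distrib_left coeff2_monom
      by (intro sum.cong) auto
  qed
  also have "\<dots> = (\<Sum>(a, b)\<in>{..m} \<times> {..n}. \<Sum>(i, j)\<in>tri N. if (i, j) = (m - a, n - b) then coeff2 h a b * coeff2 f i j else 0)"
    unfolding split_def by (rule sum.swap)
  also have "\<dots> = coeff2 (h * f) m n"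
    unfolding coeff2_mult
  proof (rule sum.cong[OF refl])
    fix q assume "q \<in> {..m} \<times> {..n}"
    then obtain a b where q: "q = (a, b)" "a \<le> m" "b \<le> n" by auto
    have "(\<Sum>(i, j)\<in>tri N. if (i, j) = (m - a, n - b) then coeff2 h a b * coeff2 f i j else 0)
      = (\<Sum>x\<in>tri N. if x = (m - a, n - b) then coeff2 h a b * coeff2 f (m - a) (n - b) else 0)"
      by (intro sum.cong) (auto split: if_splits)
    then show "(case q of (a, b) \<Rightarrow> \<Sum>(i, j)\<in>tri N. if (i, j) = (m - a, n - b) then coeff2 h a b * coeff2 f i j else 0)
       = (case q of (a, b) \<Rightarrow> coeff2 h a b * coeff2 f (m - a) (n - b))"
      using assms q by simp
  qed
  finally show ?thesis .
qed

text \<open>A diagonal map multiplies each monomial by \<open>u ^ i * v ^ j\<close>. When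
  \<open>u v = 1\<close> this depends on \<open>i - j\<close> alone, so the map acts on each weight
  as multiplication by one series.\<close>

lemma subst2_wt_factor:
  assumes nc: "no_const (u * Z1, v * Z2)"
    and h: "\<And>i j. int i - int j = d \<Longrightarrow> u ^ i * v ^ j = h" and f: "wt d f"
  shows "subst2 f (u * Z1, v * Z2) = h * f"
proof (intro fps2_eqI)
  fix m n
  have "coeff2 f i j * coeff2 (monom2 (u * Z1, v * Z2) i j) m n
      = coeff2 f i j * coeff2 (h * (Z1 ^ i * Z2 ^ j)) m n" for i j
  proof (cases "coeff2 f i j = 0")
    case False
    then have "u ^ i * v ^ j = h" using f by (intro h) (simp add: wt_def)
    then have "monom2 (u * Z1, v * Z2) i j = h * (Z1 ^ i * Z2 ^ j)"
      by (auto simp: power_mult_distrib mult_ac)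
    then show ?thesis by simp
  qed simp
  then have "coeff2 (subst2 f (u * Z1, v * Z2)) m n
      = (\<Sum>(i, j)\<in>tri (m + n). coeff2 f i j * coeff2 (h * (Z1 ^ i * Z2 ^ j)) m n)"
    by (simp only: coeff2_subst2_raw)
  then show "coeff2 (subst2 f (u * Z1, v * Z2)) m n = coeff2 (h * f) m n"
    by (simp only: sum_coeff2_monom_mult order_refl)
qed

lemma no_const_mult_Z: "no_const (u * Z1, v * Z2)"
  using ord_ge_mult[OF ord_ge_0 ord_ge_Z1, of u] ord_ge_mult[OF ord_ge_0 ord_ge_Z2, of v] by simp

lemma subst2_wt_nonneg:
  assumes "u * v = 1" "wt (int e) f"
  shows "subst2 f (u * Z1, v * Z2) = u ^ e * f"
proof (rule subst2_wt_factor[OF no_const_mult_Z _ assms(2)])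
  fix i j assume "int i - int j = int e"
  then have "i = e + j" by simp
  then show "u ^ i * v ^ j = u ^ e"
    using assms(1) by (simp add: power_add mult.assoc power_mult_distrib[symmetric])
qed

lemma subst2_wt_nonpos:
  assumes "u * v = 1" "wt (- int e) f"
  shows "subst2 f (u * Z1, v * Z2) = v ^ e * f"
proof (rule subst2_wt_factor[OF no_const_mult_Z _ assms(2)])
  fix i j assume "int i - int j = - int e"
  then have "j = i + e" by simp
  then show "u ^ i * v ^ j = v ^ e"
    using assms(1) by (simp add: power_add mult.assoc[symmetric] power_mult_distrib[symmetric])
qed

text \<open>Each monomial has exactly one weight, of modulus at most its degree. This exact
  splitting lets the conjugacy equation be estimated one weight at a time.\<close>

lemma nrm_wproj_sum: "nrm r n f = (\<Sum>d\<in>{- int n..int n}. nrm r n (wproj d f))"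
proof -
  have "(\<Sum>d\<in>{- int n..int n}. nrm r n (wproj d f))
      = (\<Sum>p\<in>tri n. \<Sum>d\<in>{- int n..int n}. case p of (i, j) \<Rightarrow> cmod (coeff2 (wproj d f) i j) * r ^ (i + j))"
    unfolding nrm_def by (rule sum.swap)
  also have "\<dots> = nrm r n f"
    unfolding nrm_def
  proof (rule sum.cong[OF refl])
    fix p assume "p \<in> tri n"
    then obtain i j where p: "p = (i, j)" "i + j \<le> n" by (cases p) auto
    have "(\<Sum>d\<in>{- int n..int n}. cmod (coeff2 (wproj d f) i j) * r ^ (i + j))
      = (\<Sum>d\<in>{- int n..int n}. if d = int i - int j then cmod (coeff2 f i j) * r ^ (i + j) else 0)"
      by (intro sum.cong) (auto simp: coeff2_wproj)
    then show "(\<Sum>d\<in>{- int n..int n}. case p of (i, j) \<Rightarrow> cmod (coeff2 (wproj d f) i j) * r ^ (i + j))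
      = (case p of (i, j) \<Rightarrow> cmod (coeff2 f i j) * r ^ (i + j))"
      using p by simp
  qed
  finally show ?thesis by simp
qed

lemma nrm_wproj_le: "0 \<le> r \<Longrightarrow> nrm r n (wproj d f) \<le> nrm r n f"
  unfolding nrm_def by (intro sum_mono) (auto simp: coeff2_wproj intro!: mult_right_mono)

section \<open>Roots of convergent series\<close>

lemma of_nat_const2: "(of_nat k :: fps2) = const2 (of_nat k)"
proof (induction k)
  case 0 show ?case by (intro fps2_eqI) (simp add: coeff2_const2)
qed (simp add: const2_add)

lemma nrm_power_minus_one:
  assumes r: "0 \<le> r" and s: "nrm r n (s - 1) \<le> \<rho>"
  shows "nrm r n (s ^ j - 1) \<le> (1 + \<rho>) ^ j - 1"
proof (induction j)
  case (Suc j)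
  have \<rho>: "0 \<le> \<rho>" using order_trans[OF nrm_nonneg s] r by simp
  have "s ^ Suc j - 1 = (s ^ j - 1) + (s - 1) * (s ^ j - 1) + (s - 1)"
    by (simp add: algebra_simps)
  then have "nrm r n (s ^ Suc j - 1)
      \<le> nrm r n (s ^ j - 1) + nrm r n (s - 1) * nrm r n (s ^ j - 1) + nrm r n (s - 1)"
    by (simp only:) (intro order_trans[OF nrm_add] add_mono nrm_mult r order_refl)
  also have "\<dots> \<le> ((1 + \<rho>) ^ j - 1) + \<rho> * ((1 + \<rho>) ^ j - 1) + \<rho>"
    using Suc s r \<rho> by (intro add_mono mult_mono) auto
  also have "\<dots> = (1 + \<rho>) ^ Suc j - 1" by (simp add: algebra_simps)
  finally show ?case .
qed simp

text \<open>With \<open>e = s - 1\<close> one has \<open>k e = (s\<^sup>k - 1) - e \<Sum>\<^bsub>j<k\<^esub> (s\<^sup>j - 1)\<close>, and the last product is of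
  second order in \<open>e\<close>; this controls the truncations of \<open>e\<close> degree by degree.\<close>

lemma convergent2_root:
  assumes s: "coeff2 s 0 0 = 1" and conv: "convergent2 (s ^ k)" and k: "k \<ge> 1"
  shows "convergent2 s"
proof -
  define e where "e = s - 1"
  define \<sigma> where "\<sigma> = (\<Sum>j<k. s ^ j - 1)"
  have c0: "coeff2 (s ^ j) 0 0 = 1" for j
    by (induction j) (simp_all add: coeff2_1 coeff2_mult s)
  have oe: "ord_ge (Suc 0) e" and op: "ord_ge (Suc 0) (s ^ j - 1)" for j
    by (simp_all add: e_def ord_ge_Suc_0_iff coeff2_1 s c0)
  have o\<sigma>: "ord_ge (Suc 0) \<sigma>"
    by (simp add: \<sigma>_def ord_ge_Suc_0_iff coeff2_sum coeff2_1 c0)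
  have eq: "const2 (of_nat k) * e = (s ^ k - 1) - e * \<sigma>"
  proof -
    have "s ^ k - 1 = e * (\<Sum>j<k. s ^ j)" by (simp add: power_diff_1_eq e_def)
    moreover have "\<sigma> = (\<Sum>j<k. s ^ j) - of_nat k" by (simp add: \<sigma>_def sum_subtractf)
    ultimately show ?thesis by (simp only: of_nat_const2[symmetric]) (simp add: algebra_simps)
  qed
  \<comment> \<open>With \<open>(1 + \<rho>) ^ k = 3 / 2\<close>, a bound \<rho> for
    \<open>e\<close> bounds each \<open>s ^ j - 1\<close> with \<open>j < k\<close> by
    \<open>1 / 2\<close>, hence \<sigma> by \<open>k / 2\<close>.\<close>
  define \<rho> where "\<rho> = root k (3 / 2) - 1"
  have \<rho>: "\<rho> > 0" "(1 + \<rho>) ^ k = 3 / 2"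
    using k by (auto simp: \<rho>_def real_root_gt_1_iff)
  have "convergent2 (s ^ k - 1)"
    using conv convergent2_bound[of 1 1 1] by (intro convergent2_diff) auto
  then obtain C R where CR: "R > 0" "C > 0" "\<And>r n. 0 \<le> r \<Longrightarrow> r \<le> R \<Longrightarrow> nrm r n (s ^ k - 1) \<le> C * r ^ Suc 0"
    using convergent2_small[OF _ op] by metis
  \<comment> \<open>The term \<open>s ^ k - 1\<close> is then at most \<open>\<rho> / 2\<close>,
    hence at most \<open>k \<rho> / 2\<close>; the product \<open>e \<sigma>\<close> contributes
    another \<open>k \<rho> / 2\<close>, which closes the induction.\<close>
  define r where "r = min R (\<rho> / (2 * C))"
  have r: "r > 0" "r \<le> R" "C * r \<le> \<rho> / 2"
  proof -
    have "r \<le> \<rho> / (2 * C)" by (simp add: r_def)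
    then show "C * r \<le> \<rho> / 2" using CR by (simp add: field_simps)
  qed (use CR \<rho> in \<open>auto simp: r_def\<close>)
  have main: "nrm r n e \<le> \<rho>" for n
  proof (induction n)
    case 0 then show ?case using \<rho> oe by (simp add: nrm_trunc_0)
  next
    case (Suc n)
    have pw: "nrm r n (s ^ j - 1) \<le> 1 / 2" if "j < k" for j
    proof -
      have "nrm r n (s ^ j - 1) \<le> (1 + \<rho>) ^ j - 1"
        using Suc r by (intro nrm_power_minus_one) (auto simp: e_def)
      also have "(1 + \<rho>) ^ j \<le> (1 + \<rho>) ^ k" using that \<rho> by (intro power_increasing) auto
      finally show ?thesis using \<rho> by simp
    qed
    have "nrm r n \<sigma> \<le> (\<Sum>j<k. nrm r n (s ^ j - 1))"
      unfolding \<sigma>_def using r by (intro nrm_sum_le) auto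
    also have "\<dots> \<le> (\<Sum>j<k. 1 / 2)" by (intro sum_mono pw) auto
    finally have \<sigma>: "nrm r n \<sigma> \<le> real k / 2" by simp
    have "real k * nrm r (Suc n) e = nrm r (Suc n) ((s ^ k - 1) - e * \<sigma>)"
      by (simp flip: eq)
    also have "\<dots> \<le> nrm r (Suc n) (s ^ k - 1) + nrm r (Suc n) (e * \<sigma>)"
      using r by (intro nrm_diff) auto
    also have "nrm r (Suc n) (e * \<sigma>) \<le> nrm r n e * nrm r n \<sigma>"
      using nrm_mult_ord[OF _ oe o\<sigma>, of r "Suc n"] r by simp
    also have "nrm r n e * nrm r n \<sigma> \<le> \<rho> * (real k / 2)"
      using Suc \<sigma> r \<rho> by (intro mult_mono) auto
    also have "nrm r (Suc n) (s ^ k - 1) \<le> \<rho> / 2"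
      using CR(3)[of r "Suc n"] r by simp
    finally have "real k * nrm r (Suc n) e \<le> \<rho> / 2 + \<rho> * (real k / 2)" by simp
    also have "\<dots> \<le> real k * \<rho>"
      using k \<rho> mult_right_mono[of 1 "real k" \<rho>] by (simp add: field_simps)
    finally show ?case using k by simp
  qed
  have "nrm r n s \<le> 1 + \<rho>" for n
    using nrm_add[of r n 1 e] main[of n] r by (simp add: e_def)
  then show ?thesis using r by (intro convergent2_bound)
qed

text \<open>Multiplication by a variable shifts the degree by one and scales the norm by
  \<open>r\<close>.\<close>

lemma convergent2_cancel_Z1: "convergent2 (Z1 * f) \<Longrightarrow> convergent2 f"
  and convergent2_cancel_Z2: "convergent2 (Z2 * f) \<Longrightarrow> convergent2 f"
proof -
  have cancel: "convergent2 f" if h: "\<And>r n. nrm r (Suc n) g = r * nrm r n f" and g: "convergent2 g" for g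
  proof -
    obtain r B where rB: "r > 0" "\<And>n. nrm r n g \<le> B"
      using g convergent2_iff_nrm by blast
    have "nrm r n f \<le> B / r" for n
      using rB(2)[of "Suc n"] rB(1) by (simp add: h field_simps)
    then show ?thesis using rB by (intro convergent2_bound)
  qed
  show "convergent2 (Z1 * f) \<Longrightarrow> convergent2 f" "convergent2 (Z2 * f) \<Longrightarrow> convergent2 f"
    by (auto intro: cancel nrm_Z1_mult nrm_Z2_mult)
qed

lemma convergent2_cancel_power_Z:
  assumes "convergent2 ((Z1 * (Z2 * s)) ^ k)"
  shows "convergent2 (s ^ k)"
proof -
  have 1: "convergent2 (Z1 ^ m * f) \<Longrightarrow> convergent2 f" for m f
    by (induction m) (auto simp: mult.assoc intro: convergent2_cancel_Z1)
  have 2: "convergent2 (Z2 ^ m * f) \<Longrightarrow> convergent2 f" for m f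
    by (induction m) (auto simp: mult.assoc intro: convergent2_cancel_Z2)
  show ?thesis using assms 1 2 by (metis power_mult_distrib)
qed

section \<open>The resonance estimate\<close>

text \<open>As \<open>x\<close> has no constant term, only the truncation of \<open>a\<close> at
  degree \<open>n - 1\<close> enters; this is the one known at that stage of the induction.\<close>

lemma nrm_power_mult:
  assumes "0 \<le> r" "nrm r (n - 1) a \<le> \<theta>" "ord_ge (Suc 0) x"
  shows "nrm r n (a ^ m * x) \<le> \<theta> ^ m * nrm r n x"
proof -
  have "nrm r n (a ^ m * x) \<le> nrm r (n - 1) (a ^ m) * nrm r n x"
    using nrm_mult_ord[OF assms(1) ord_ge_0 assms(3), of n "a ^ m"] by simp
  also have "\<dots> \<le> \<theta> ^ m * nrm r n x"
    using assms by (intro mult_right_mono order_trans[OF nrm_power power_mono]) auto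
  finally show ?thesis .
qed

text \<open>Meant for \<open>\<theta> ^ m < |c|\<close>: the constant dominates, and the equation is
  solved for \<open>c x\<close>.\<close>

lemma nrm_solve_small:
  assumes "0 \<le> r" "nrm r (n - 1) a \<le> \<theta>" "ord_ge (Suc 0) x" "a ^ m * x = const2 c * x + y"
  shows "(cmod c - \<theta> ^ m) * nrm r n x \<le> nrm r n y"
proof -
  have "const2 c * x = a ^ m * x - y" using assms(4) by simp
  then have "cmod c * nrm r n x \<le> nrm r n (a ^ m * x) + nrm r n y"
    using nrm_diff[OF assms(1), of n "a ^ m * x" y] by (simp flip: nrm_const_mult)
  also have "nrm r n (a ^ m * x) \<le> \<theta> ^ m * nrm r n x" by (intro nrm_power_mult assms)
  finally show ?thesis by (simp add: algebra_simps)
qed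

text \<open>Meant for \<open>\<theta> ^ m * |c| < 1\<close>: here \<open>b ^ m\<close> dominates,
  and multiplying by its inverse \<open>a ^ m\<close> isolates \<open>x\<close>.\<close>

lemma nrm_solve_large:
  assumes "0 \<le> r" "nrm r (n - 1) a \<le> \<theta>" "\<theta> \<le> 1" "ord_ge (Suc 0) x" "ord_ge (Suc 0) y"
    and "a * b = 1" "b ^ m * x = const2 c * x + y"
  shows "(1 - \<theta> ^ m * cmod c) * nrm r n x \<le> nrm r n y"
proof -
  have \<theta>: "0 \<le> \<theta>" using order_trans[OF nrm_nonneg assms(2)] assms(1) by simp
  have "x = a ^ m * (b ^ m * x)"
    using assms(6) by (simp add: mult.assoc[symmetric] power_mult_distrib[symmetric])
  also have "\<dots> = a ^ m * (const2 c * x + y)" using assms(7) by simp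
  finally have "nrm r n x = nrm r n (a ^ m * (const2 c * x + y))" by simp
  also have "\<dots> \<le> \<theta> ^ m * nrm r n (const2 c * x + y)"
    using assms by (intro nrm_power_mult ord_ge_add ord_ge_const_mult) auto
  also have "\<dots> \<le> \<theta> ^ m * (cmod c * nrm r n x + nrm r n y)"
    using nrm_add[OF assms(1), of n "const2 c * x" y] \<theta> by (intro mult_left_mono) auto
  also have "\<dots> \<le> \<theta> ^ m * cmod c * nrm r n x + 1 * nrm r n y"
    using mult_right_mono[OF power_le_one[OF \<theta> assms(3), of m] nrm_nonneg[OF assms(1), of n y]]
    by (simp add: algebra_simps)
  finally show ?thesis by (simp add: algebra_simps)
qed

text \<open>Here \<open>a\<close> is the contracting one of the two multipliers \<open>u\<close>, \<open>v\<close> of \<open>N = (u z\<^sub>1, v z\<^sub>2)\<close>, \<open>b\<close> is the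
  other one, and \<open>\<sigma> = \<plusminus>1\<close> is the weight on which \<open>N\<close> acts as multiplication by \<open>a\<close>. The only weight on
  which \<open>u\<^sup>d - c\<close> is not uniformly invertible is the resonant one.\<close>

lemma nrm_nonresonant_weight:
  assumes r: "0 \<le> r" and ab: "a * b = 1" and a: "nrm r (n - 1) a \<le> \<theta>"
    and \<theta>: "0 < \<rho>" "\<rho> < \<theta>" "\<theta> < 1" "\<theta>\<^sup>2 < \<rho>"
    and \<sigma>: "\<sigma> = 1 \<or> \<sigma> = -1"
    and N: "\<And>x m. wt (\<sigma> * int m) x \<Longrightarrow> subst2 x N = a ^ m * x"
      "\<And>x m. wt (- \<sigma> * int m) x \<Longrightarrow> subst2 x N = b ^ m * x"
      "wt 1 (fst N)" "wt (-1) (snd N)"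
    and x: "ord_ge (Suc 0) x" and y: "ord_ge (Suc 0) y"
    and eq: "subst2 x N = const2 c * x + y"
    and c: "(cmod c = \<rho> \<and> \<tau> = \<sigma>) \<or> (cmod c = 1 / \<rho> \<and> \<tau> = - \<sigma>)"
    and d: "d \<noteq> \<tau>"
  shows "min (\<rho> - \<theta>\<^sup>2) (1 - \<rho>) * nrm r n (wproj d x) \<le> nrm r n (wproj d y)"
proof -
  let ?x = "wproj d x" and ?y = "wproj d y" and ?\<kappa> = "min (\<rho> - \<theta>\<^sup>2) (1 - \<rho>)"
  have o: "ord_ge (Suc 0) ?x" "ord_ge (Suc 0) ?y" using x y by (auto intro: ord_ge_wproj)
  have eqd: "subst2 ?x N = const2 c * ?x + ?y"
    using wproj_subst2[OF N(3,4), of d x] by (simp add: eq wproj_add wproj_const_mult)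
  have pow: "\<theta> ^ m \<le> 1" "2 \<le> m \<Longrightarrow> \<theta> ^ m \<le> \<theta>\<^sup>2" for m
    using \<theta> by (auto intro: power_le_one power_decreasing)
  have \<rho>1: "\<rho> < 1" using \<theta> by simp
  have scale: "?\<kappa> * nrm r n ?x \<le> nrm r n ?y" if "t * nrm r n ?x \<le> nrm r n ?y" "?\<kappa> \<le> t" for t
    using that(1) mult_right_mono[OF that(2) nrm_nonneg[OF r, of n ?x]] by linarith
  \<comment> \<open>The gaps for \<open>|c| = 1 / \<rho>\<close> are those for
    \<open>|c| = \<rho>\<close> divided by \<open>\<rho> < 1\<close>, hence no smaller.\<close>
  have div: "1 - \<rho> \<le> 1 / \<rho> - 1" "\<rho> - \<theta>\<^sup>2 \<le> 1 - \<theta>\<^sup>2 / \<rho>"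
  proof -
    have "1 / \<rho> - 1 = (1 - \<rho>) / \<rho>" "1 - \<theta>\<^sup>2 / \<rho> = (\<rho> - \<theta>\<^sup>2) / \<rho>" using \<theta> by (auto simp: field_simps)
    moreover have "t \<le> t / \<rho>" if "0 \<le> t" for t
      using that \<theta> \<rho>1 mult_left_le[of \<rho> t] by (simp add: field_simps)
    ultimately show "1 - \<rho> \<le> 1 / \<rho> - 1" "\<rho> - \<theta>\<^sup>2 \<le> 1 - \<theta>\<^sup>2 / \<rho>" using \<theta> \<rho>1 by auto
  qed
  define m where "m = nat \<bar>d\<bar>"
  consider (pos) "d = \<sigma> * int m" | (neg) "d = - \<sigma> * int m" "m \<noteq> 0"
    using \<sigma> by (cases "d = 0"; cases "d < 0") (auto simp: m_def)
  then show ?thesis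
  proof cases
    case pos
    have "a ^ m * ?x = const2 c * ?x + ?y"
      using N(1)[of m ?x] wt_wproj[of d x] eqd pos by simp
    then have *: "(cmod c - \<theta> ^ m) * nrm r n ?x \<le> nrm r n ?y"
      using r a o by (intro nrm_solve_small)
    show ?thesis
      using c
    proof
      assume c: "cmod c = \<rho> \<and> \<tau> = \<sigma>"
      then have "m \<noteq> 1" using d pos by auto
      show ?thesis
      proof (cases "m = 0")
        \<comment> \<open>On weight zero the map acts as the identity, which dominates
          \<open>|c| = \<rho> < 1\<close>; so the estimate isolating \<open>x\<close> applies, with
          gap \<open>1 - \<rho>\<close>.\<close>
        case True
        then have "b ^ m * ?x = const2 c * ?x + ?y"
          using N(2)[of m ?x] wt_wproj[of d x] eqd pos by simp
        then have "(1 - \<theta> ^ m * cmod c) * nrm r n ?x \<le> nrm r n ?y"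
          using r a o ab \<theta> by (intro nrm_solve_large) auto
        then show ?thesis by (rule scale) (use True c in auto)
      next
        case False
        \<comment> \<open>The value \<open>m = 1\<close> is the resonance; beyond it
          \<open>\<theta>\<^sup>2 < \<rho>\<close> keeps \<open>a ^ m\<close> below
          \<open>c\<close>.\<close>
        then have "2 \<le> m" using \<open>m \<noteq> 1\<close> by simp
        with * show ?thesis by (intro scale[OF *]) (use c pow(2)[of m] in auto)
      qed
    next
      assume c: "cmod c = 1 / \<rho> \<and> \<tau> = - \<sigma>"
      show ?thesis by (rule scale[OF *]) (use c pow(1)[of m] div in auto)
    qed
  next
    case neg
    have "b ^ m * ?x = const2 c * ?x + ?y"
      using N(2)[of m ?x] wt_wproj[of d x] eqd neg by simp
    then have *: "(1 - \<theta> ^ m * cmod c) * nrm r n ?x \<le> nrm r n ?y"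
      using r a o ab \<theta> by (intro nrm_solve_large) auto
    show ?thesis
      using c
    proof
      assume c: "cmod c = \<rho> \<and> \<tau> = \<sigma>"
      have "\<theta> ^ m * \<rho> \<le> 1 * \<rho>" using pow(1)[of m] \<theta> by (intro mult_right_mono) auto
      then show ?thesis by (intro scale[OF *]) (use c in auto)
    next
      assume c: "cmod c = 1 / \<rho> \<and> \<tau> = - \<sigma>"
      then have "2 \<le> m" using d neg by (cases "m = 1") auto
      then have "\<theta> ^ m / \<rho> \<le> \<theta>\<^sup>2 / \<rho>" using pow(2) \<theta> by (intro divide_right_mono) auto
      then show ?thesis using div(2) by (intro scale[OF *]) (use c in auto)
    qed
  qed
qed

lemma nrm_nonresonant:
  assumes r: "0 \<le> r" and \<kappa>: "0 < \<kappa>"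
    and bound: "\<And>d. d \<noteq> \<tau> \<Longrightarrow> \<kappa> * nrm r n (wproj d x) \<le> nrm r n (wproj d y)"
    and res: "nrm r n (wproj \<tau> x) \<le> t"
  shows "\<kappa> * nrm r n x \<le> \<kappa> * t + nrm r n y"
proof -
  have t: "0 \<le> t" using order_trans[OF nrm_nonneg res] r by simp
  let ?I = "{- int n..int n}"
  have "\<kappa> * nrm r n x = (\<Sum>d\<in>?I. \<kappa> * nrm r n (wproj d x))"
    by (subst nrm_wproj_sum) (simp add: sum_distrib_left)
  also have "\<dots> \<le> (\<Sum>d\<in>?I. (if d = \<tau> then \<kappa> * t else 0) + nrm r n (wproj d y))"
    using \<kappa> r bound res by (intro sum_mono) (auto intro!: add_increasing2 mult_left_mono)
  also have "\<dots> \<le> \<kappa> * t + nrm r n y"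
    using \<kappa> t by (simp add: sum.distrib nrm_wproj_sum[of r n y])
  finally show ?thesis .
qed

text \<open>One induction bounds \<open>H\<close> and \<open>w\<close> together: a bound for
  \<open>H\<close> at degree \<open>n\<close> bounds \<open>w\<close>, hence the multiplier
  \<open>a\<close>, at degree \<open>n\<close>, and this makes the nonresonant weights solvable at
  degree \<open>n + 1\<close>. The hypothesis \<open>aw\<close> records how \<open>w\<close>
  controls \<open>a\<close>, so that the cases where \<open>u\<close> or \<open>v\<close> contracts
  are treated at once.\<close>

lemma resonance_core:
  assumes ab: "a * b = 1" and \<rho>: "0 < \<rho>" "\<rho> < 1"
    and \<sigma>: "\<sigma> = 1 \<or> \<sigma> = -1"
    and N: "\<And>x m. wt (\<sigma> * int m) x \<Longrightarrow> subst2 x N = a ^ m * x"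
      "\<And>x m. wt (- \<sigma> * int m) x \<Longrightarrow> subst2 x N = b ^ m * x"
      "wt 1 (fst N)" "wt (-1) (snd N)"
    and H: "no_const H" "wproj 1 (fst H) = Z1" "wproj (-1) (snd H) = Z2"
    and f: "ord_ge 2 f" "convergent2 f" and g: "ord_ge 2 g" "convergent2 g"
    and eq1: "subst2 (fst H) N = const2 c * fst H + subst2 f H"
    and eq2: "subst2 (snd H) N = const2 c' * snd H + subst2 g H"
    and c: "(cmod c = \<rho> \<and> 1 = \<sigma>) \<or> (cmod c = 1 / \<rho> \<and> 1 = - \<sigma>)"
    and c': "(cmod c' = \<rho> \<and> -1 = \<sigma>) \<or> (cmod c' = 1 / \<rho> \<and> -1 = - \<sigma>)"
    and w: "const2 c * (Z1 * w) = wproj 1 (subst2 f H)"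
    and aw: "\<And>r n W. 0 \<le> r \<Longrightarrow> W < 1 \<Longrightarrow> nrm r n w \<le> W \<Longrightarrow> nrm r n a * (1 - W) \<le> \<rho>"
  shows "convergent2 (fst H)" "convergent2 (snd H)" "convergent2 w"
proof -
  \<comment> \<open>The bound \<theta> for \<open>a\<close> lies above \<rho> to leave room for the
    perturbation \<open>w\<close>, and below the root so that
    \<open>\<theta>\<^sup>2 < \<rho>\<close> keeps the higher powers of \<open>a\<close> away from
    the resonance.\<close>
  have "\<rho> < sqrt \<rho>" using \<rho> real_less_rsqrt[of \<rho> \<rho>] by (simp add: power2_eq_square)
  then obtain \<theta> where \<theta>: "\<rho> < \<theta>" "\<theta> < sqrt \<rho>" using dense by blast
  have "\<theta>\<^sup>2 < (sqrt \<rho>)\<^sup>2" using \<theta> \<rho> by (intro power_strict_mono) auto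
  moreover have "sqrt \<rho> < 1" using \<rho> by simp
  ultimately have \<theta>': "\<theta>\<^sup>2 < \<rho>" "\<theta> < 1" using \<theta> \<rho> by (simp, linarith)
  define \<kappa> where "\<kappa> = min (\<rho> - \<theta>\<^sup>2) (1 - \<rho>)"
  have \<kappa>: "\<kappa> > 0" using \<theta>' \<rho> by (simp add: \<kappa>_def)
  \<comment> \<open>Since \<open>1 - W = \<rho> / \<theta>\<close>, the hypothesis \<open>aw\<close>
    turns the bound \<open>W\<close> for \<open>w\<close> into the bound \<theta> for
    \<open>a\<close>.\<close>
  define W where "W = 1 - \<rho> / \<theta>"
  have W: "0 < W" "W < 1" using \<theta> \<rho> by (auto simp: W_def)
  have a_le: "nrm r n a \<le> \<theta>" if "0 \<le> r" "nrm r n w \<le> W" for r n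
    using aw[OF that(1) W(2) that(2)] \<rho> \<theta> by (simp add: W_def field_simps)
  have c0: "cmod c > 0" using c \<rho> by auto
  obtain C1 R1 where 1: "R1 > 0" "C1 > 0" "\<And>r n. 0 \<le> r \<Longrightarrow> r \<le> R1 \<Longrightarrow> nrm r n f \<le> C1 * r ^ 2"
    using convergent2_small[OF f(2,1)] by metis
  obtain C2 R2 where 2: "R2 > 0" "C2 > 0" "\<And>r n. 0 \<le> r \<Longrightarrow> r \<le> R2 \<Longrightarrow> nrm r n g \<le> C2 * r ^ 2"
    using convergent2_small[OF g(2,1)] by metis
  \<comment> \<open>The substituted nonlinear parts will be at most \<open>L * r\<close>:
    \<open>L \<le> \<kappa>\<close> serves to bound \<open>H\<close>, and
    \<open>L \<le> W * cmod c\<close> to bound \<open>w\<close>.\<close>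
  define L where "L = min \<kappa> (W * cmod c)"
  have L: "L > 0" "L \<le> \<kappa>" "L \<le> W * cmod c" using \<kappa> W c0 by (auto simp: L_def)
  \<comment> \<open>At radius \<open>2 r\<close> the series \<open>f\<close> and \<open>g\<close>
    are at most \<open>4 C r\<^sup>2\<close> with their constants \<open>C\<close>; this choice
    makes that at most \<open>L r\<close>.\<close>
  define r where "r = min (min (R1 / 2) (R2 / 2)) (min (L / (4 * C1)) (L / (4 * C2)))"
  have r: "r > 0" "2 * r \<le> R1" "2 * r \<le> R2" using 1 2 L by (auto simp: r_def)
  have "r \<le> L / (4 * C1)" "r \<le> L / (4 * C2)" by (auto simp: r_def)
  then have "4 * C1 * r \<le> L" "4 * C2 * r \<le> L" using 1 2 by (auto simp: field_simps)
  then have *: "(4 * C1 * r) * r \<le> L * r" "(4 * C2 * r) * r \<le> L * r"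
    using r by (auto intro!: mult_right_mono)
  have small: "nrm (2 * r) n f \<le> L * r" "nrm (2 * r) n g \<le> L * r" for n
  proof -
    have "C1 * (2 * r)\<^sup>2 = (4 * C1 * r) * r" "C2 * (2 * r)\<^sup>2 = (4 * C2 * r) * r"
      by (simp_all add: power2_eq_square)
    then show "nrm (2 * r) n f \<le> L * r" "nrm (2 * r) n g \<le> L * r"
      using 1(3)[of "2 * r" n] 2(3)[of "2 * r" n] r * by linarith+
  qed
  have o: "ord_ge (Suc 0) (subst2 f H)" "ord_ge (Suc 0) (subst2 g H)"
    using f g H by (auto intro!: ord_ge_subst2 intro: ord_ge_mono)
  have step: "nrm r n w \<le> W \<and> nrm r (Suc n) (fst H) \<le> 2 * r \<and> nrm r (Suc n) (snd H) \<le> 2 * r"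
    if IH: "nrm r n (fst H) \<le> 2 * r" "nrm r n (snd H) \<le> 2 * r" for n
  proof -
    have Y: "nrm r (Suc n) (subst2 f H) \<le> L * r" "nrm r (Suc n) (subst2 g H) \<le> L * r"
      using nrm_subst2_pred[OF _ H(1) f(1), of r "Suc n" "2 * r"]
        nrm_subst2_pred[OF _ H(1) g(1), of r "Suc n" "2 * r"] IH r small[of "Suc n"] by auto
    \<comment> \<open>Multiplication by \<open>Z1\<close> shifts the degree, so \<open>w\<close> up
      to degree \<open>n\<close> is read off the resonant part at degree
      \<open>n + 1\<close>.\<close>
    have "cmod c * (r * nrm r n w) = nrm r (Suc n) (wproj 1 (subst2 f H))"
      by (simp flip: w add: nrm_Z1_mult)
    also have "\<dots> \<le> nrm r (Suc n) (subst2 f H)" using r by (intro nrm_wproj_le) auto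
    also have "\<dots> \<le> (W * cmod c) * r" using Y(1) L(3) r mult_right_mono[of L "W * cmod c" r] by linarith
    finally have wW: "nrm r n w \<le> W" using c0 r by (simp add: mult_ac)
    have an: "nrm r (Suc n - 1) a \<le> \<theta>" using a_le[OF _ wW] r by simp
    have "\<kappa> * nrm r (Suc n) (fst H) \<le> \<kappa> * r + nrm r (Suc n) (subst2 f H)"
    proof (rule nrm_nonresonant)
      show "\<kappa> * nrm r (Suc n) (wproj d (fst H)) \<le> nrm r (Suc n) (wproj d (subst2 f H))" if "d \<noteq> 1" for d
        unfolding \<kappa>_def
        by (rule nrm_nonresonant_weight[OF _ ab an \<rho>(1) \<theta>(1) \<theta>'(2,1) \<sigma> N _ o(1) eq1 c that]) (use r H in auto)
    qed (use r \<kappa> H nrm_Z1 in auto)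
    moreover have "\<kappa> * nrm r (Suc n) (snd H) \<le> \<kappa> * r + nrm r (Suc n) (subst2 g H)"
    proof (rule nrm_nonresonant)
      show "\<kappa> * nrm r (Suc n) (wproj d (snd H)) \<le> nrm r (Suc n) (wproj d (subst2 g H))" if "d \<noteq> -1" for d
        unfolding \<kappa>_def
        by (rule nrm_nonresonant_weight[OF _ ab an \<rho>(1) \<theta>(1) \<theta>'(2,1) \<sigma> N _ o(2) eq2 c' that]) (use r H in auto)
    qed (use r \<kappa> H nrm_Z2 in auto)
    moreover have "L * r \<le> \<kappa> * r" using L r by (intro mult_right_mono) auto
    \<comment> \<open>The resonant part contributes \<open>\<kappa> r\<close> and the others at most
      \<open>L r \<le> \<kappa> r\<close>, which reproduces the bound \<open>2 r\<close>.\<close>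
    ultimately have "\<kappa> * nrm r (Suc n) (fst H) \<le> \<kappa> * (2 * r)" "\<kappa> * nrm r (Suc n) (snd H) \<le> \<kappa> * (2 * r)"
      using Y by auto
    then show ?thesis using wW \<kappa> by simp
  qed
  have main: "nrm r n (fst H) \<le> 2 * r \<and> nrm r n (snd H) \<le> 2 * r" for n
  proof (induction n)
    case 0 then show ?case using r H by (simp add: nrm_trunc_0)
  qed (use step in auto)
  show "convergent2 (fst H)" "convergent2 (snd H)" "convergent2 w"
    using main step r by (auto intro: convergent2_bound[of r])
qed

text \<open>The contracting multiplier is \<open>u\<close> for \<open>|lam| < 1\<close> and
  \<open>v\<close> for \<open>|lam| > 1\<close>; both cases are instances of the same induction,
  with \<rho> equal to \<open>|lam|\<close> or \<open>1 / |lam|\<close>.\<close>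

lemma convergent_resonant_conjugacy:
  fixes u v w :: fps2
  assumes lam: "lam \<noteq> 0" "cmod lam \<noteq> 1"
    and u: "u = const2 lam * (1 + w)" and uv: "u * v = 1"
    and N: "wt 1 (u * Z1)" "wt (-1) (v * Z2)"
    and H: "no_const H" "wproj 1 (fst H) = Z1" "wproj (-1) (snd H) = Z2"
    and f: "ord_ge 2 f" "convergent2 f" and g: "ord_ge 2 g" "convergent2 g"
    and eq1: "subst2 (fst H) (u * Z1, v * Z2) = const2 lam * fst H + subst2 f H"
    and eq2: "subst2 (snd H) (u * Z1, v * Z2) = const2 (1 / lam) * snd H + subst2 g H"
  shows "convergent2 (fst H)" "convergent2 (snd H)" "convergent2 w"
proof -
  let ?N = "(u * Z1, v * Z2)"
  \<comment> \<open>The weight-one part of the first equation: because \<open>fst H\<close> has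
    resonant part \<open>Z1\<close>, it becomes a formula for \<open>w\<close>.\<close>
  have "u * Z1 = wproj 1 (subst2 (fst H) ?N)"
    using wproj_subst2[of ?N 1 "fst H"] N H(2) subst2_Z1[OF no_const_mult_Z] by simp
  then have "u * Z1 = const2 lam * Z1 + wproj 1 (subst2 f H)"
    by (simp only: eq1 wproj_add wproj_const_mult H(2))
  moreover have "u * Z1 = const2 lam * Z1 + const2 lam * (Z1 * w)" by (simp add: u algebra_simps)
  ultimately have w: "const2 lam * (Z1 * w) = wproj 1 (subst2 f H)" by simp
  have up: "\<And>x m. wt (int m) x \<Longrightarrow> subst2 x ?N = u ^ m * x"
    and vp: "\<And>x m. wt (- int m) x \<Longrightarrow> subst2 x ?N = v ^ m * x"
    using subst2_wt_nonneg[OF uv] subst2_wt_nonpos[OF uv] by auto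
  have "convergent2 (fst H) \<and> convergent2 (snd H) \<and> convergent2 w"
  proof (cases "cmod lam < 1")
    case True
    have aw: "nrm r n u * (1 - W) \<le> cmod lam" if "0 \<le> r" "W < 1" "nrm r n w \<le> W" for r n W
    proof -
      have W: "0 \<le> W" using order_trans[OF nrm_nonneg that(3)] that(1) by simp
      have "nrm r n u \<le> cmod lam * (1 + W)"
        using nrm_add[OF that(1), of n 1 w] that(3) by (auto simp: u intro!: mult_left_mono)
      then have "nrm r n u * (1 - W) \<le> cmod lam * (1 + W) * (1 - W)"
        using that by (intro mult_right_mono) auto
      also have "\<dots> = cmod lam * (1 - W\<^sup>2)" by (simp add: algebra_simps power2_eq_square)
      also have "\<dots> \<le> cmod lam * 1" by (intro mult_left_mono) auto
      finally show ?thesis by simp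
    qed
    show ?thesis
      using resonance_core[where a = u and b = v and \<rho> = "cmod lam" and \<sigma> = 1 and N = ?N and H = H
          and f = f and g = g and c = lam and c' = "1 / lam" and w = w]
        uv True lam up vp N H f g eq1 eq2 w aw
      by (auto simp: norm_divide)
  next
    case False
    then have lam1: "cmod lam > 1" using lam by simp
    have aw: "nrm r n v * (1 - W) \<le> 1 / cmod lam" if "0 \<le> r" "W < 1" "nrm r n w \<le> W" for r n W
    proof -
      \<comment> \<open>Writing \<open>v = 1 / lam - v w\<close> bounds \<open>v\<close> without
        inverting \<open>1 + w\<close>; the term \<open>v w\<close> is absorbed into the factor
        \<open>1 - W\<close>.\<close>
      have "const2 lam * v = 1 - v * w * const2 lam" using uv by (simp add: u algebra_simps)
      then have "const2 (1 / lam) * (const2 lam * v) = const2 (1 / lam) * (1 - v * w * const2 lam)" by simp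
      moreover have "const2 (1 / lam) * const2 lam = 1" using lam by (simp flip: const2_mult)
      ultimately have "v = const2 (1 / lam) * 1 - v * w"
        by (simp add: algebra_simps)
      then have "nrm r n v \<le> nrm r n (const2 (1 / lam) * 1) + nrm r n (v * w)"
        using nrm_diff[OF that(1), of n "const2 (1 / lam) * 1" "v * w"] by simp
      also have "\<dots> \<le> 1 / cmod lam + nrm r n v * W"
        using that nrm_const_mult[of r n "1 / lam" 1]
        by (auto simp: norm_divide intro!: order_trans[OF nrm_mult] mult_left_mono)
      finally show ?thesis by (simp add: algebra_simps)
    qed
    show ?thesis
      using resonance_core[where a = v and b = u and \<rho> = "1 / cmod lam" and \<sigma> = "-1" and N = ?N and H = H
          and f = f and g = g and c = lam and c' = "1 / lam" and w = w]
        uv lam1 lam up vp N H f g eq1 eq2 w aw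
      by (auto simp: norm_divide mult.commute[of v u])
  qed
  then show "convergent2 (fst H)" "convergent2 (snd H)" "convergent2 w" by auto
qed

section \<open>Normalising the formal conjugacy\<close>

lemma const2_power: "const2 c ^ n = const2 (c ^ n)"
  by (induction n) (simp_all add: const2_mult)

definition diag_germ :: "complex \<Rightarrow> fps2 \<times> fps2" where
  "diag_germ c = (const2 c * Z1, const2 (1 / c) * Z2)"

lemma const2_inverse: "c \<noteq> 0 \<Longrightarrow> const2 c * const2 (1 / c) = 1"
  by (simp flip: const2_mult)

lemma diag_germ_mem_G2: "c \<noteq> 0 \<Longrightarrow> diag_germ c \<in> carrier G2"
  unfolding mem_G2 invertible_det_nz det_2
  by (simp add: diag_germ_def no_const_mult_Z coeff2_Z1 coeff2_Z2 ord_ge_const_mult)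

lemma coeff2_subst2_diag_germ: "coeff2 (subst2 f (diag_germ c)) m n = c ^ m * (1 / c) ^ n * coeff2 f m n"
proof -
  have "monom2 (diag_germ c) i j = const2 (c ^ i * (1 / c) ^ j) * (Z1 ^ i * Z2 ^ j)" for i j
    by (simp add: diag_germ_def power_mult_distrib const2_power const2_mult mult_ac)
  then have "coeff2 (subst2 f (diag_germ c)) m n
      = (\<Sum>(i, j)\<in>tri (m + n). coeff2 f i j * ((c ^ i * (1 / c) ^ j) * coeff2 (Z1 ^ i * Z2 ^ j) m n))"
    by (simp only: coeff2_subst2_raw coeff2_const_mult)
  also have "\<dots> = (\<Sum>x\<in>tri (m + n). if x = (m, n) then c ^ m * (1 / c) ^ n * coeff2 f m n else 0)"
    by (intro sum.cong) (auto simp: coeff2_monom split: if_splits)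
  finally show ?thesis by simp
qed

lemma power_inject_norm_ne_1:
  fixes x :: real
  assumes "0 < x" "x \<noteq> 1" "x ^ m = x ^ n"
  shows "m = n"
proof (rule ccontr)
  assume "m \<noteq> n"
  then consider "m < n" | "n < m" by linarith
  then show False
    using power_strict_increasing[of m n x] power_strict_increasing[of n m x]
      power_strict_decreasing[of m n x] power_strict_decreasing[of n m x] assms
    by cases (cases "x < 1"; simp)+
qed

text \<open>A nonzero coefficient at \<open>(i, j)\<close> forces \<open>c ^ (i - j)\<close> to
  equal \<open>c\<close>, respectively \<open>1 / c\<close>. Distinct powers of \<open>c\<close>
  differ because \<open>|c| \<noteq> 1\<close>, so only resonant monomials survive.\<close>

lemma wt_of_commute_diag:
  assumes c: "c \<noteq> 0" "cmod c \<noteq> 1" and C: "comp2 C (diag_germ c) = comp2 (diag_germ c) C" "no_const C"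
  shows "wt 1 (fst C)" "wt (-1) (snd C)"
proof -
  have eq: "subst2 (fst C) (diag_germ c) = const2 c * fst C" "subst2 (snd C) (diag_germ c) = const2 (1 / c) * snd C"
    using C by (auto simp: comp2_def diag_germ_def)
  have inj: "m = n" if "c ^ m = c ^ n" for m n
    using power_inject_norm_ne_1[of "cmod c" m n] c that by (metis norm_power zero_less_norm_iff)
  show "wt 1 (fst C)"
    unfolding wt_def
  proof (intro allI impI)
    fix i j assume "coeff2 (fst C) i j \<noteq> 0"
    then have "c ^ i * (1 / c) ^ j = c"
      using arg_cong[OF eq(1), of "\<lambda>f. coeff2 f i j"] by (simp add: coeff2_subst2_diag_germ)
    then have "c ^ i = c ^ Suc j" using c by (simp add: power_divide field_simps)
    then have "i = Suc j" by (rule inj)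
    then show "int i - int j = 1" by simp
  qed
  show "wt (-1) (snd C)"
    unfolding wt_def
  proof (intro allI impI)
    fix i j assume nz: "coeff2 (snd C) i j \<noteq> 0"
    have "(c ^ i * (1 / c) ^ j) * coeff2 (snd C) i j = (1 / c) * coeff2 (snd C) i j"
      using arg_cong[OF eq(2), of "\<lambda>f. coeff2 f i j"]
      by (simp only: coeff2_subst2_diag_germ coeff2_const_mult)
    with nz have "c ^ i * (1 / c) ^ j = 1 / c" by (simp only: mult_cancel_right) simp
    then have "c ^ Suc i = c ^ j" using c by (simp add: power_divide field_simps)
    then have "Suc i = j" by (rule inj)
    then show "int i - int j = -1" by simp
  qed
qed

lemma wproj_mult:
  assumes u: "wt 0 u"
  shows "wproj d (u * f) = u * wproj d f"
proof (intro fps2_eqI)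
  fix m n
  show "coeff2 (wproj d (u * f)) m n = coeff2 (u * wproj d f) m n"
  proof (cases "int m - int n = d")
    case True
    have "coeff2 u a b * coeff2 f (m - a) (n - b) = coeff2 u a b * coeff2 (wproj d f) (m - a) (n - b)"
      if "a \<le> m" "b \<le> n" for a b
    proof (cases "coeff2 u a b = 0")
      case False
      then have "int a - int b = 0" using u unfolding wt_def by blast
      then have "int (m - a) - int (n - b) = d" using that True by simp
      then show ?thesis by (simp add: coeff2_wproj)
    qed simp
    then have "coeff2 (u * f) m n = coeff2 (u * wproj d f) m n"
      unfolding coeff2_mult by (intro sum.cong) auto
    then show ?thesis by (simp add: coeff2_wproj True)
  next
    case False
    have "wt (0 + d) (u * wproj d f)" by (intro wt_mult u wt_wproj)
    then show ?thesis using False by (auto simp: wt_def coeff2_wproj)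
  qed
qed

text \<open>The weight-zero part of \<open>v\<close> is an inverse of \<open>u\<close> as well, so
  it equals \<open>v\<close>.\<close>

lemma wt_inverse:
  assumes "wt 0 u" "u * v = 1"
  shows "wt 0 v"
proof -
  have "u * wproj 0 v = 1" using wproj_mult[OF assms(1), of 0 v] assms(2) wt_wproj_eq[OF wt_1] by simp
  then have "wproj 0 v = (v * u) * wproj 0 v" "v * (u * wproj 0 v) = v"
    using assms(2) by (simp_all add: mult.commute)
  then have "wproj 0 v = v" by (simp add: mult.assoc)
  then show ?thesis using wt_wproj[of 0 v] by simp
qed

section \<open>Conjugacy relations in a group, and the normalised conjugacy\<close>

lemma (in group) conj_eq_iff:
  assumes "x \<in> carrier G" "f \<in> carrier G" "a \<in> carrier G"
  shows "inv x \<otimes> f \<otimes> x = a \<longleftrightarrow> f \<otimes> x = x \<otimes> a"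
proof
  assume "inv x \<otimes> f \<otimes> x = a"
  then have "x \<otimes> a = x \<otimes> (inv x \<otimes> (f \<otimes> x))" using assms by (simp add: m_assoc)
  also have "\<dots> = f \<otimes> x" using assms by (simp flip: m_assoc)
  finally show "f \<otimes> x = x \<otimes> a" by simp
next
  assume "f \<otimes> x = x \<otimes> a"
  then have "inv x \<otimes> (f \<otimes> x) = inv x \<otimes> (x \<otimes> a)" by simp
  also have "\<dots> = a" using assms by (simp flip: m_assoc)
  finally show "inv x \<otimes> f \<otimes> x = a" using assms by (simp add: m_assoc)
qed

lemma (in group) conj_trans:
  assumes "x \<in> carrier G" "y \<in> carrier G" "f \<in> carrier G" "g \<in> carrier G" "h \<in> carrier G"
    and "f \<otimes> x = x \<otimes> g" "g \<otimes> y = y \<otimes> h"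
  shows "f \<otimes> (x \<otimes> y) = (x \<otimes> y) \<otimes> h"
  using assms by (metis m_assoc)

lemma (in group) conj_sym:
  assumes "x \<in> carrier G" "f \<in> carrier G" "g \<in> carrier G" "f \<otimes> x = x \<otimes> g"
  shows "g \<otimes> inv x = inv x \<otimes> f"
proof -
  have "g = inv x \<otimes> f \<otimes> x" using conj_eq_iff[of x f g] assms by simp
  then show ?thesis using assms(1-3) by (simp add: m_assoc)
qed

text \<open>Composing the formal conjugacy with the inverse of its resonant part \<open>D\<close> makes it normalised, at the
  price of replacing \<open>A\<close> by \<open>N = D A D\<^sup>-\<^sup>1\<close>, which is still of the form \<open>(u z\<^sub>1, v z\<^sub>2)\<close> with \<open>u v = 1\<close>.\<close>

lemma normalised_conjugacy:
  assumes lam: "lam \<noteq> 0" "cmod lam \<noteq> 1" and k: "k \<ge> 1"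
    and F: "F \<in> biholomorphic_germs" and H: "H \<in> carrier G2" "linear_part H = mat 1"
    and A: "mapA lam k \<in> carrier G2" and FH: "comp2 F H = comp2 H (mapA lam k)"
  shows "\<exists>K\<in>biholomorphic_germs. comp2 F K = comp2 K (mapA lam k)"
proof -
  let ?A = "mapA lam k" and ?\<Lambda> = "diag_germ lam"
  define U where "U = const2 lam * (1 + (Z1 * Z2) ^ k)"
  define V where "V = inverse U"
  have UV: "U * V = 1" using mapA_unit[OF lam(1) k] by (simp add: U_def V_def)
  have A_eq: "?A = (U * Z1, V * Z2)" by (simp add: mapA_def U_def V_def Let_def)
  have "wt 0 ((Z1 * Z2) ^ k)" using wt_power[OF wt_mult[OF wt_Z1 wt_Z2], of k] by simp
  then have wU: "wt 0 U" by (auto simp: U_def wt_def coeff2_1 split: if_splits)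

  define D where "D = (wproj 1 (fst H), wproj (-1) (snd H))"
  have ncH: "no_const H" using H by (simp add: mem_G2)
  have ncD: "no_const D" using ncH by (simp add: D_def ord_ge_wproj)
  have linD: "linear_part D = mat 1"
    using H(2) by (simp add: mat2_eq_iff D_def coeff2_wproj mat_def)
  have D: "D \<in> carrier G2" using ncD linD by (auto simp: mem_G2 invertible_def)
  have wD: "wt (int 1) (fst D)" "wt (- int 1) (snd D)" by (simp_all add: D_def wt_wproj)
  define C where "C = inv\<^bsub>G2\<^esub> D"
  have C: "C \<in> carrier G2" and DC: "comp2 D C = (Z1, Z2)"
    using D G2.r_inv[OF D] by (simp_all add: C_def one_G2)
  have ncC: "no_const C" using C by (simp add: mem_G2)
  have linC: "linear_part C = mat 1"
    using linear_part_comp2[OF ncC, of D] by (simp add: DC linear_part_id linD)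
  have DC': "subst2 (fst D) C = Z1" "subst2 (snd D) C = Z2"
    using DC by (auto simp: comp2_def)

  have \<Lambda>: "?\<Lambda> \<in> carrier G2" using lam by (intro diag_germ_mem_G2)
  \<comment> \<open>Resonance of \<open>D\<close> means commuting with the linear part of
    \<open>A\<close>. This passes to the inverse \<open>C\<close>, whose components therefore have
    weights \<open>1\<close> and \<open>-1\<close>.\<close>
  have "comp2 ?\<Lambda> D = comp2 D ?\<Lambda>"
    using subst2_wt_nonneg[OF const2_inverse[OF lam(1)] wD(1)]
      subst2_wt_nonpos[OF const2_inverse[OF lam(1)] wD(2)] ncD
    by (simp add: comp2_def diag_germ_def)
  then have "comp2 ?\<Lambda> C = comp2 C ?\<Lambda>"
    using G2.conj_sym[OF D \<Lambda> \<Lambda>] by (simp add: C_def)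
  then have wC: "wt 1 (fst C)" "wt (-1) (snd C)"
    using wt_of_commute_diag[OF lam _ ncC] by auto

  \<comment> \<open>\<open>q\<close> is \<open>z1 z2\<close> composed with \<open>C\<close>; thus
    \<open>u\<close> and \<open>v\<close> are the multipliers of \<open>A\<close> in the new
    coordinates.\<close>
  define q where "q = fst C * snd C"
  define u where "u = subst2 U C"
  define v where "v = subst2 V C"
  have u: "u = const2 lam * (1 + q ^ k)"
    by (simp add: u_def U_def q_def subst2_mult[OF ncC] subst2_power[OF ncC] ncC)
  have uv: "u * v = 1"
    using subst2_mult[OF ncC, of U V] by (simp add: UV u_def v_def)
  have wu: "wt 0 u" unfolding u_def by (intro wt_subst2 wC wU)
  have wv: "wt 0 v" by (rule wt_inverse[OF wu uv])
  let ?N = "(u * Z1, v * Z2)"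
  have wN: "wt 1 (u * Z1)" "wt (-1) (v * Z2)"
    using wt_mult[OF wu wt_Z1] wt_mult[OF wv wt_Z2] by simp_all
  \<comment> \<open>On weights \<open>1\<close> and \<open>-1\<close> substituting \<open>A\<close>
    is multiplication by \<open>U\<close> and \<open>V\<close>; composing with the inverse
    \<open>C\<close> of \<open>D\<close> then leaves a diagonal map.\<close>
  have DA: "comp2 D ?A = (U * fst D, V * snd D)"
    using subst2_wt_nonneg[OF UV wD(1)] subst2_wt_nonpos[OF UV wD(2)] by (simp add: comp2_def A_eq)
  have N: "comp2 (comp2 D ?A) C = ?N"
    unfolding DA by (simp add: comp2_def subst2_mult[OF ncC] DC' u_def v_def)
  have N_mem: "?N \<in> carrier G2" using G2_closed[OF G2_closed[OF D A] C] by (simp add: N)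

  have NC: "comp2 ?A C = comp2 C ?N"
  proof -
    have "?N \<otimes>\<^bsub>G2\<^esub> D = D \<otimes>\<^bsub>G2\<^esub> ?A"
    proof -
      have "?N \<otimes>\<^bsub>G2\<^esub> D = D \<otimes>\<^bsub>G2\<^esub> ?A \<otimes>\<^bsub>G2\<^esub> (inv\<^bsub>G2\<^esub> D \<otimes>\<^bsub>G2\<^esub> D)"
        using G2.m_assoc[OF G2.m_closed[OF D A] C D] by (simp only: N[symmetric] C_def mult_G2)
      then show ?thesis using D A by (simp del: mult_G2)
    qed
    then show ?thesis using G2.conj_sym[OF D N_mem A] by (simp add: C_def)
  qed
  define H' where "H' = comp2 H C"
  have F': "F \<in> carrier G2" using F by (simp add: biholomorphic_germs_def)
  have H'_mem: "H' \<in> carrier G2" using G2_closed[OF H(1) C] by (simp add: H'_def)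
  then have ncH': "no_const H'" by (simp add: mem_G2)
  have FH': "comp2 F H' = comp2 H' ?N"
    using G2.conj_trans[OF H(1) C F' A N_mem] FH NC by (simp add: H'_def)
  \<comment> \<open>Substituting \<open>C\<close> respects weights, so the resonant part of
    \<open>H'\<close> is \<open>D\<close> composed with \<open>C\<close>, the identity.\<close>
  have proj: "wproj 1 (fst H') = Z1" "wproj (-1) (snd H') = Z2"
    using wproj_subst2[OF wC, of 1 "fst H"] wproj_subst2[OF wC, of "-1" "snd H"] DC'
    by (simp_all add: H'_def D_def)

  have linF: "linear_part F = linear_part (diag_germ lam)"
  proof -
    have "linear_part F = linear_part ?A"
      using linear_part_comp2[OF ncH, of F] linear_part_comp2[of ?A H] A FH H(2) by (simp add: mem_G2)
    also have "\<dots> = linear_part (diag_germ lam)"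
    proof -
      have U0: "coeff2 U 0 0 = lam"
        using k by (simp add: U_def coeff2_1 Z1_def Z2_def coeff2_def const2_def fps_nth_power_0 power_0_left)
      have "coeff2 (U * V) 0 0 = 1" by (simp add: UV coeff2_1)
      then have "coeff2 V 0 0 = 1 / lam" using lam by (simp add: coeff2_mult U0 field_simps)
      then show ?thesis
        by (simp add: A_eq mat2_eq_iff diag_germ_def mult.commute[of U] mult.commute[of V]
            coeff2_Z1_mult coeff2_Z2_mult coeff2_Z1 coeff2_Z2 U0)
    qed
    finally show ?thesis .
  qed
  have ncF: "no_const F" using F' by (simp add: mem_G2)
  have const2_0: "const2 0 = 0" by (intro fps2_eqI) (simp add: coeff2_const2)
  have LF: "linear_germ (linear_part F) = diag_germ lam"
    by (simp add: linF linear_germ_def diag_germ_def coeff2_Z1 coeff2_Z2 const2_0)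
  let ?f = "fst (nonlinear_part F)" and ?g = "snd (nonlinear_part F)"
  have F_split: "fst F = const2 lam * Z1 + ?f" "snd F = const2 (1 / lam) * Z2 + ?g"
    by (simp_all add: nonlinear_part_def LF diag_germ_def)
  have fg: "ord_ge 2 ?f" "ord_ge 2 ?g" using ord_ge_nonlinear_part[OF ncF] by auto
  have cfg: "convergent2 ?f" "convergent2 ?g"
    using F convergent2_linear_germ[of "linear_part F"]
    by (auto simp: nonlinear_part_def biholomorphic_germs_def intro: convergent2_diff)
  have eq1: "subst2 (fst H') ?N = const2 lam * fst H' + subst2 ?f H'"
    using arg_cong[OF FH', of fst] arg_cong[OF F_split(1), of "\<lambda>x. subst2 x H'"] ncH' by simp
  have eq2: "subst2 (snd H') ?N = const2 (1 / lam) * snd H' + subst2 ?g H'"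
    using arg_cong[OF FH', of snd] arg_cong[OF F_split(2), of "\<lambda>x. subst2 x H'"] ncH' by simp
  have conv: "convergent2 (fst H')" "convergent2 (snd H')" "convergent2 (q ^ k)"
    using convergent_resonant_conjugacy[OF lam u uv wN ncH' proj fg(1) cfg(1) fg(2) cfg(2) eq1 eq2] by auto

  \<comment> \<open>Weight \<open>1\<close> forces divisibility by \<open>z1\<close> and weight
    \<open>-1\<close> by \<open>z2\<close>, whence \<open>q = z1 z2 s\<close>.\<close>
  define \<alpha> where "\<alpha> = Abs_fps (\<lambda>i. fps_nth (fst C) (Suc i))"
  define \<beta> where "\<beta> = Abs_fps (\<lambda>i. Abs_fps (\<lambda>j. coeff2 (snd C) i (Suc j)))"
  have \<alpha>\<beta>: "coeff2 \<alpha> i j = coeff2 (fst C) (Suc i) j" "coeff2 \<beta> i j = coeff2 (snd C) i (Suc j)" for i j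
    by (simp_all add: \<alpha>_def \<beta>_def coeff2_def)
  have C0: "coeff2 (fst C) 0 j = 0" "coeff2 (snd C) j 0 = 0" for j
    using wC unfolding wt_def by (smt (verit) of_nat_0 of_nat_0_le_iff)+
  have C_fac: "fst C = Z1 * \<alpha>" "snd C = Z2 * \<beta>"
    by (intro fps2_eqI; simp add: coeff2_Z1_mult coeff2_Z2_mult \<alpha>\<beta> C0)+
  define s where "s = \<alpha> * \<beta>"
  have q: "q = Z1 * (Z2 * s)" by (simp add: q_def C_fac s_def mult_ac)
  have s0: "coeff2 s 0 0 = 1"
    using linC by (simp add: s_def coeff2_mult \<alpha>\<beta> mat2_eq_iff mat_def)
  have conv_s: "convergent2 s"
    using convergent2_root[OF s0 convergent2_cancel_power_Z k] conv(3) by (simp add: q)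
  \<comment> \<open>\<open>G\<close> replaces \<open>C\<close>, whose convergence is not
    established: its components have the same product \<open>q\<close>, so \<open>U\<close> and
    \<open>V\<close> pull back to the same \<open>u\<close> and \<open>v\<close>.\<close>
  define G where "G = (Z1, Z2 * s)"
  have ncG: "no_const G" by (simp add: G_def ord_ge_Suc_0_iff coeff2_Z1 coeff2_Z2_mult)
  have linG: "linear_part G = mat 1"
    by (simp add: G_def mat2_eq_iff mat_def coeff2_Z1 coeff2_Z2_mult s0)
  have G: "G \<in> biholomorphic_germs"
    using ncG linG conv_s convergent2_Z1 convergent2_Z2
    by (auto simp: biholomorphic_germs_def mem_G2 invertible_def G_def intro: convergent2_mult)
  have G': "G \<in> carrier G2" using G by (simp add: biholomorphic_germs_def)
  have ws: "wt (- int 1) (Z2 * s)"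
    unfolding wt_def
  proof (intro allI impI)
    fix i j assume "coeff2 (Z2 * s) i j \<noteq> 0"
    then have "coeff2 q (Suc i) j \<noteq> 0" by (simp add: q coeff2_Z1_mult)
    then have "int (Suc i) - int j = 1 + (-1)"
      using wt_mult[OF wC] unfolding q_def wt_def by blast
    then show "int i - int j = - int 1" by simp
  qed
  have AG: "comp2 ?A G = comp2 G ?N"
  proof -
    have UG: "subst2 U G = u"
      by (simp add: U_def u q subst2_mult[OF ncG] subst2_power[OF ncG] ncG)
         (simp add: G_def)
    have "u * subst2 V G = 1" using subst2_mult[OF ncG, of U V] by (simp add: UV UG)
    then have "v * (u * subst2 V G) = v" by simp
    moreover have "v * (u * subst2 V G) = (u * v) * subst2 V G" by (simp only: mult_ac)
    ultimately have VG: "subst2 V G = v" by (simp add: uv)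
    show ?thesis
      using subst2_wt_nonpos[OF uv ws] subst2_Z1[OF no_const_mult_Z, of u v]
      by (simp add: comp2_def A_eq subst2_mult[OF ncG] UG VG ncG)
         (simp add: G_def)
  qed
  \<comment> \<open>\<open>H'\<close> conjugates \<open>F\<close> to \<open>?N\<close>, and the
    inverse of \<open>G\<close> conjugates \<open>?N\<close> to \<open>A\<close>; both
    converge.\<close>
  have "comp2 ?N (inv\<^bsub>G2\<^esub> G) = comp2 (inv\<^bsub>G2\<^esub> G) ?A"
    using G2.conj_sym[OF G' A N_mem] AG by simp
  then have "comp2 F (comp2 H' (inv\<^bsub>G2\<^esub> G)) = comp2 (comp2 H' (inv\<^bsub>G2\<^esub> G)) ?A"
    using G2.conj_trans[OF H'_mem _ F' N_mem A] FH' G2.inv_closed[OF G'] by simp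
  moreover have "comp2 H' (inv\<^bsub>G2\<^esub> G) \<in> biholomorphic_germs"
    using conv H'_mem G by (intro biholomorphic_germs_closed biholomorphic_germs_inv)
      (auto simp: biholomorphic_germs_def)
  ultimately show ?thesis by blast
qed

section \<open>Reduction to a formal conjugacy tangent to the identity\<close>

theorem theorem1p6:
  fixes lam :: complex and k :: nat and F :: "fps2 \<times> fps2"
  assumes "lam \<noteq> 0" and "cmod lam \<noteq> 1" and "k \<ge> 1"
    and "F \<in> biholomorphic_germs"
    and "\<exists>H \<in> carrier G2. inv\<^bsub>G2\<^esub> H \<otimes>\<^bsub>G2\<^esub> F \<otimes>\<^bsub>G2\<^esub> H = mapA lam k"
  shows "\<exists>K \<in> biholomorphic_germs. inv\<^bsub>G2\<^esub> K \<otimes>\<^bsub>G2\<^esub> F \<otimes>\<^bsub>G2\<^esub> K = mapA lam k"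
proof -
  let ?A = "mapA lam k"
  obtain H where H: "H \<in> carrier G2" "inv\<^bsub>G2\<^esub> H \<otimes>\<^bsub>G2\<^esub> F \<otimes>\<^bsub>G2\<^esub> H = ?A" using assms(5) by blast
  have F: "F \<in> carrier G2" using assms(4) by (simp add: biholomorphic_germs_def)
  have A: "?A \<in> carrier G2"
    using G2.m_closed[OF G2.m_closed[OF G2.inv_closed[OF H(1)] F] H(1)] by (simp only: H(2))
  have FH: "F \<otimes>\<^bsub>G2\<^esub> H = H \<otimes>\<^bsub>G2\<^esub> ?A" using G2.conj_eq_iff[OF H(1) F A] H(2) by blast
  \<comment> \<open>Linear germs converge, so conjugating \<open>F\<close> by the linear part of
    \<open>H\<close> keeps it biholomorphic, while the new conjugacy \<open>H'\<close> becomes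
    tangent to the identity.\<close>
  define M where "M = linear_germ (linear_part H)"
  have M: "M \<in> biholomorphic_germs" "M \<in> carrier G2"
    using H(1) no_const_linear_germ convergent2_linear_germ
    by (auto simp: M_def biholomorphic_germs_def mem_G2)
  define F' where "F' = inv\<^bsub>G2\<^esub> M \<otimes>\<^bsub>G2\<^esub> F \<otimes>\<^bsub>G2\<^esub> M"
  define H' where "H' = inv\<^bsub>G2\<^esub> M \<otimes>\<^bsub>G2\<^esub> H"
  have F': "F' \<in> biholomorphic_germs" "F' \<in> carrier G2"
    using biholomorphic_germs_closed[OF biholomorphic_germs_closed[OF biholomorphic_germs_inv[OF M(1)] assms(4)] M(1)]
    by (simp_all add: F'_def biholomorphic_germs_def)
  have H': "H' \<in> carrier G2" unfolding H'_def using M H by (intro G2.m_closed G2.inv_closed)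
  have FM: "F \<otimes>\<^bsub>G2\<^esub> M = M \<otimes>\<^bsub>G2\<^esub> F'" using G2.conj_eq_iff[OF M(2) F F'(2)] by (simp add: F'_def)
  have MH': "M \<otimes>\<^bsub>G2\<^esub> H' = H"
    using G2.m_assoc[OF M(2) G2.inv_closed[OF M(2)] H(1)] G2.r_inv[OF M(2)] G2.l_one[OF H(1)]
    by (simp only: H'_def)
  have "F' \<otimes>\<^bsub>G2\<^esub> H' = H' \<otimes>\<^bsub>G2\<^esub> ?A"
    unfolding H'_def
    by (rule G2.conj_trans[OF G2.inv_closed[OF M(2)] H(1) F'(2) F A G2.conj_sym[OF M(2) F F'(2) FM] FH])
  then have F'H': "comp2 F' H' = comp2 H' ?A" by simp
  have ncH': "no_const H'" using H' by (simp add: mem_G2)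
  obtain P where P: "P ** linear_part H = mat 1" using H(1) by (auto simp: mem_G2 invertible_def)
  have "linear_part H ** linear_part H' = linear_part H"
    using linear_part_comp2[OF ncH', of M] MH' by (simp add: M_def)
  then have "linear_part H' = mat 1"
    using P by (metis matrix_mul_assoc matrix_mul_lid)
  then obtain K where K: "K \<in> biholomorphic_germs" "comp2 F' K = comp2 K ?A"
    using normalised_conjugacy[OF assms(1-3) F'(1) H' _ A F'H'] by blast
  have K': "K \<in> carrier G2" using K by (simp add: biholomorphic_germs_def)
  have MK: "comp2 M K \<in> biholomorphic_germs" "comp2 M K \<in> carrier G2"
    using biholomorphic_germs_closed[OF M(1) K(1)] by (simp_all add: biholomorphic_germs_def)
  have "F \<otimes>\<^bsub>G2\<^esub> (M \<otimes>\<^bsub>G2\<^esub> K) = (M \<otimes>\<^bsub>G2\<^esub> K) \<otimes>\<^bsub>G2\<^esub> ?A"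
    by (rule G2.conj_trans[OF M(2) K' F F'(2) A FM]) (simp add: K)
  then have "inv\<^bsub>G2\<^esub> (comp2 M K) \<otimes>\<^bsub>G2\<^esub> F \<otimes>\<^bsub>G2\<^esub> comp2 M K = ?A"
    using G2.conj_eq_iff[OF MK(2) F A] by simp
  with MK(1) show ?thesis by blast
qed

end
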